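(* The quadratic form $\langle 2,3,6,7\rangle$ represents every prime other than $23$, $47$ and $67$, and represents none of $23,47,67$. Consequently, the quadratic forms $\langle 2,3,6,6,7\rangle$; $\langle 2,3,6,7,a_5\rangle$ with $7\le a_5\le 23$, $a_5\notin\{8,19,20,22\}$; $\langle 2,3,6,7,19,20\rangle$; and $\langle 2,3,6,7,20,a_6\rangle$ with $20\le a_6\le 67$, $a_6\notin\{21,23,63,66\}$, are prime-universal. Moreover, the quadratic forms $\langle 2,3,6,7,19\rangle$ and $\langle 2,3,6,7,22\rangle$ each represent every prime except $23$ (and do not represent $23$), and $\langle 2,3,6,7,20\rangle$ represents every prime except $67$ (and does not represent $67$).
   Context: For positive integers $a_1,\dots,a_n$, $\langle a_1,\dots,a_n\rangle$ denotes the diagonal quadratic form $a_1x_1^2+\cdots+a_nx_n^2$; it represents $m$ if $a_1x_1^2+\cdots+a_nx_n^2=m$ has an integer solution, and it is prime-universal if it represents every prime. *)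

theory Defs
  imports Main "HOL-Computational_Algebra.Primes"
begin

text \<open>The list \<open>[a\<^sub>1, \<dots>, a\<^sub>n]\<close> stands for the diagonal form
  \<open>\<langle>a\<^sub>1, \<dots>, a\<^sub>n\<rangle>\<close>. Positivity of the coefficients is not part of the type.\<close>

definition diag_form :: "nat list \<Rightarrow> int list \<Rightarrow> int" where
  "diag_form as xs = (\<Sum>i<length as. int (as ! i) * (xs ! i)\<^sup>2)"

definition represents :: "nat list \<Rightarrow> nat \<Rightarrow> bool" where
  "represents as m \<longleftrightarrow> (\<exists>xs. length xs = length as \<and> diag_form as xs = int m)"

definition prime_universal :: "nat list \<Rightarrow> bool" where
  "prime_universal as \<longleftrightarrow> (\<forall>p. prime p \<longrightarrow> represents as p)"

end

theory Submission
  imports Defs "HOL-Analysis.Analysis" "HOL-Number_Theory.Number_Theory"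
    "HOL-Library.Discrete_Functions" "HOL-Computational_Algebra.Squarefree"
begin

text \<open>
  The vectors \<open>(1,-1,0)\<close>, \<open>(1,1,1)\<close>, \<open>(1,1,-2)\<close> are orthogonal of norms \<open>2\<close>, \<open>3\<close>, \<open>6\<close>, so a number
  \<open>n \<noteq> 1 (mod 3)\<close> that is a sum of three squares is represented by \<open>\<langle>2,3,6\<rangle>\<close>: two of the three squares
  have bases of equal parity, and the signs can be chosen so that the sum of the bases is divisible by
  \<open>3\<close>. For a prime \<open>p\<close> (large enough, the others being checked by hand) some \<open>w \<in> {0, 2, 4, 6}\<close> makes
  \<open>n = p - 7w\<^sup>2\<close> congruent to \<open>1\<close> modulo \<open>4\<close> or to \<open>3\<close> modulo \<open>8\<close> and not to \<open>1\<close> modulo \<open>3\<close>, so the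
  three-squares theorem in these two classes suffices.

  For squarefree \<open>n\<close> in these classes choose a prime \<open>q \<equiv> 1 (mod 4)\<close> such that, with \<open>Q = q\<close> or \<open>Q = 2q\<close>,
  \<open>-Q\<close> is a square modulo every prime divisor of \<open>n\<close>. By reciprocity \<open>n\<close> is a square modulo \<open>Q\<close>, so a
  pigeonhole argument solves \<open>n T\<^sup>2 = z\<^sup>2 + Q s\<^sup>2\<close>; as \<open>Q\<close> is a sum of two squares, \<open>n T\<^sup>2\<close> is a sum of
  three, and the Davenport--Cassels descent removes \<open>T\<close>.

  The prime \<open>q\<close> is only subject to conditions on quadratic characters, so Dirichlet's argument is needed
  for real characters only. Their non-vanishing at \<open>1\<close> follows Monsky: if \<open>\<Sum> X(n)/n = 0\<close>, the Lambert
  series \<open>\<Sum> X(n) x\<^sup>n/(1 - x\<^sup>n)\<close>, whose coefficients are nonnegative and at least \<open>1\<close> at the squares, would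
  stay bounded as \<open>x\<close> tends to \<open>1\<close>.
\<close>

section \<open>Two summation lemmas\<close>

text \<open>Summation by parts with partial sums counted from \<open>m\<close>: these are
  differences of two sums bounded by \<open>B\<close>, hence at most \<open>2 * B\<close> in
  absolute value, and the decrements of \<open>a\<close> telescope.\<close>

lemma abel_sum_bound:
  fixes c a :: "nat \<Rightarrow> real"
  assumes B: "\<And>k. \<bar>\<Sum>i<k. c i\<bar> \<le> B"
    and dec: "\<And>n. n \<ge> m \<Longrightarrow> a (Suc n) \<le> a n"
    and nonneg: "\<And>n. n \<ge> m \<Longrightarrow> 0 \<le> a n"
  shows "\<bar>\<Sum>i\<in>{m..<k}. c i * a i\<bar> \<le> 2 * B * a m"
proof (cases "m \<le> k")
  case True
  define T where "T k = (\<Sum>i<k. c i) - (\<Sum>i<m. c i)" for k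
  have T: "\<bar>T k\<bar> \<le> 2 * B" for k
    using B[of k] B[of m] by (simp add: T_def)
  have T_Suc: "T (Suc k) = T k + c k" for k
    by (simp add: T_def)
  have "(\<Sum>i\<in>{m..<k}. c i * a i) = T k * a k + (\<Sum>i\<in>{m..<k}. T (Suc i) * (a i - a (Suc i)))
     \<and> \<bar>\<Sum>i\<in>{m..<k}. T (Suc i) * (a i - a (Suc i))\<bar> \<le> 2 * B * (a m - a k)"
    using True
  proof (induction k rule: dec_induct)
    case base
    then show ?case by (simp add: T_def)
  next
    case (step k)
    have "\<bar>T (Suc k) * (a k - a (Suc k))\<bar> \<le> 2 * B * (a k - a (Suc k))"
      using T[of "Suc k"] dec[of k] step by (simp add: abs_mult mult_right_mono)
    moreover have "2 * B * (a m - a k) + 2 * B * (a k - a (Suc k)) = 2 * B * (a m - a (Suc k))"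
      by (simp add: algebra_simps)
    moreover have "(\<Sum>i\<in>{m..<Suc k}. T (Suc i) * (a i - a (Suc i)))
        = (\<Sum>i\<in>{m..<k}. T (Suc i) * (a i - a (Suc i))) + T (Suc k) * (a k - a (Suc k))"
      "(\<Sum>i\<in>{m..<Suc k}. c i * a i) = (\<Sum>i\<in>{m..<k}. c i * a i) + c k * a k"
      using step by simp_all
    moreover have "T k * a k + c k * a k = T (Suc k) * a (Suc k) + T (Suc k) * (a k - a (Suc k))"
      by (simp add: T_Suc algebra_simps)
    ultimately show ?case using step.IH by linarith
  qed
  moreover have "\<bar>T k * a k\<bar> \<le> 2 * B * a k"
    using T[of k] nonneg[of k] True by (simp add: abs_mult mult_right_mono)
  moreover have "2 * B * a k + 2 * B * (a m - a k) = 2 * B * a m"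
    by (simp add: algebra_simps)
  ultimately show ?thesis by linarith
next
  case False
  have "0 \<le> B" using B[of 0] by simp
  then show ?thesis using False nonneg[of m] by simp
qed

text \<open>The second claim bounds the tail through \<open>a m\<close> alone, which makes estimates
  uniform when \<open>a\<close> depends on a parameter. Monotonicity is asked only from
  \<open>m\<close> on: \<open>ln n * n powr - s\<close>, for instance, need not decrease before
  \<open>n = 3\<close>.\<close>

lemma dirichlet_test:
  fixes c a :: "nat \<Rightarrow> real"
  assumes B: "\<And>k. \<bar>\<Sum>i<k. c i\<bar> \<le> B"
    and dec: "\<And>n. n \<ge> m \<Longrightarrow> a (Suc n) \<le> a n"
    and lim: "a \<longlonglongrightarrow> 0"
  shows "summable (\<lambda>n. c n * a n)"
    and "\<bar>(\<Sum>n. c n * a n) - (\<Sum>n<m. c n * a n)\<bar> \<le> 2 * B * a m"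
proof -
  have nonneg: "0 \<le> a n" if "n \<ge> m" for n
  proof -
    have "decseq (\<lambda>k. a (k + m))"
      using dec by (auto intro!: decseq_SucI)
    moreover have "(\<lambda>k. a (k + m)) \<longlonglongrightarrow> 0"
      using lim by (rule LIMSEQ_ignore_initial_segment)
    ultimately show ?thesis
      using decseq_ge[of "\<lambda>k. a (k + m)" 0 "n - m"] that by simp
  qed
  have "0 \<le> B" using B[of 0] by simp
  show summ: "summable (\<lambda>n. c n * a n)"
    unfolding summable_Cauchy
  proof (intro allI impI)
    fix e :: real assume "e > 0"
    have "(\<lambda>n. 2 * B * a n) \<longlonglongrightarrow> 0"
      using tendsto_mult[OF tendsto_const lim, of "2 * B"] by simp
    then have "eventually (\<lambda>n. 2 * B * a n < e) sequentially"
      using \<open>e > 0\<close> by (rule order_tendstoD)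
    then obtain M where M: "\<And>n. n \<ge> M \<Longrightarrow> 2 * B * a n < e"
      unfolding eventually_sequentially by blast
    show "\<exists>N. \<forall>m\<ge>N. \<forall>n. norm (\<Sum>n = m..<n. c n * a n) < e"
    proof (intro exI allI impI)
      fix i j assume i: "i \<ge> max M m"
      have "\<bar>\<Sum>n\<in>{i..<j}. c n * a n\<bar> \<le> 2 * B * a i"
        by (rule abel_sum_bound) (use B dec nonneg i in auto)
      also have "\<dots> < e" using M[of i] i by simp
      finally show "norm (\<Sum>n = i..<j. c n * a n) < e" by simp
    qed
  qed
  have "(\<lambda>k. \<bar>(\<Sum>n<k. c n * a n) - (\<Sum>n<m. c n * a n)\<bar>)
      \<longlonglongrightarrow> \<bar>(\<Sum>n. c n * a n) - (\<Sum>n<m. c n * a n)\<bar>"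
    by (intro tendsto_intros summable_LIMSEQ summ)
  moreover have "eventually (\<lambda>k. \<bar>(\<Sum>n<k. c n * a n) - (\<Sum>n<m. c n * a n)\<bar> \<le> 2 * B * a m) sequentially"
    using eventually_ge_at_top[of m]
  proof eventually_elim
    case (elim k)
    have "(\<Sum>n<k. c n * a n) - (\<Sum>n<m. c n * a n) = (\<Sum>n\<in>{m..<k}. c n * a n)"
      using sum_diff_nat_ivl[of 0 m k "\<lambda>n. c n * a n"] elim by (simp add: atLeast0LessThan)
    moreover have "\<bar>\<Sum>n\<in>{m..<k}. c n * a n\<bar> \<le> 2 * B * a m"
      by (rule abel_sum_bound) (use B dec nonneg in auto)
    ultimately show ?case by simp
  qed
  ultimately show "\<bar>(\<Sum>n. c n * a n) - (\<Sum>n<m. c n * a n)\<bar> \<le> 2 * B * a m"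
    by (rule tendsto_upperbound) simp
qed

text \<open>Regroups the pairs \<open>(d, e)\<close> by their product \<open>n = d * e\<close>. This
  turns a Lambert series into a power series, and a product of two Dirichlet series into a single
  one.\<close>

lemma infsum_divisor_pairs:
  fixes g :: "nat \<Rightarrow> nat \<Rightarrow> real"
  assumes "(\<lambda>(d, e). g d e) summable_on {1..} \<times> {1..}"
  shows "(\<Sum>\<^sub>\<infinity>d\<in>{1..}. \<Sum>\<^sub>\<infinity>e\<in>{1..}. g d e) = (\<Sum>\<^sub>\<infinity>n\<in>{1..}. \<Sum>d | d dvd n. g d (n div d))"
    and "(\<lambda>n. \<Sum>d | d dvd n. g d (n div d)) summable_on {1..}"
proof -
  let ?S = "SIGMA n:{1::nat..}. {d. d dvd n}"
  have bij: "bij_betw (\<lambda>(n, d). (d, n div d)) ?S ({1::nat..} \<times> {1::nat..})"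
    by (rule bij_betw_byWitness[where f' = "\<lambda>(d, e). (d * e, d)"])
       (auto simp: Suc_le_eq dvd_div_mult_self intro: Nat.gr0I elim!: dvdE)
  have summ: "(\<lambda>(n, d). g d (n div d)) summable_on ?S"
    using summable_on_reindex_bij_betw[OF bij, of "\<lambda>(d, e). g d e"] assms
    by (simp add: case_prod_beta')
  have fin: "(\<Sum>\<^sub>\<infinity>d | d dvd n. g d (n div d)) = (\<Sum>d | d dvd n. g d (n div d))" if "n \<in> {1..}" for n
    using that by (intro infsum_finite) auto
  have "(\<Sum>\<^sub>\<infinity>d\<in>{1..}. \<Sum>\<^sub>\<infinity>e\<in>{1..}. g d e) = (\<Sum>\<^sub>\<infinity>(d, e)\<in>{1..} \<times> {1..}. g d e)"
    using infsum_Sigma'_banach[OF assms] by simp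
  also have "\<dots> = (\<Sum>\<^sub>\<infinity>(n, d)\<in>?S. g d (n div d))"
    using infsum_reindex_bij_betw[OF bij, of "\<lambda>(d, e). g d e"] by (simp add: case_prod_beta')
  also have "\<dots> = (\<Sum>\<^sub>\<infinity>n\<in>{1..}. \<Sum>\<^sub>\<infinity>d | d dvd n. g d (n div d))"
    using infsum_Sigma'_banach[OF summ] by simp
  also have "\<dots> = (\<Sum>\<^sub>\<infinity>n\<in>{1..}. \<Sum>d | d dvd n. g d (n div d))"
    by (intro infsum_cong fin)
  finally show "(\<Sum>\<^sub>\<infinity>d\<in>{1..}. \<Sum>\<^sub>\<infinity>e\<in>{1..}. g d e) = (\<Sum>\<^sub>\<infinity>n\<in>{1..}. \<Sum>d | d dvd n. g d (n div d))" .
  have "(\<lambda>n. \<Sum>\<^sub>\<infinity>d | d dvd n. g d (n div d)) summable_on {1..}"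
    using summable_on_Sigma_banach[OF summ] by simp
  then show "(\<lambda>n. \<Sum>d | d dvd n. g d (n div d)) summable_on {1..}"
    by (rule summable_on_cong[THEN iffD1, rotated]) (use fin in auto)
qed

section \<open>Real characters and their values at 1\<close>

text \<open>Here \<open>N\<close> is any period, not necessarily the conductor, and \<open>X\<close>
  may be nonzero at numbers sharing a factor with \<open>N\<close>. The witness of
  \<open>nonprincipal\<close> is prime to \<open>N\<close>, so that multiplication by it permutes
  the residues.\<close>

locale real_character =
  fixes X :: "nat \<Rightarrow> real" and N :: nat
  assumes mult: "X (m * n) = X m * X n"
    and one: "X 1 = 1"
    and vals: "X n \<in> {-1, 0, 1}"
    and N_pos: "N > 0"
    and periodic: "X (n + N) = X n"
    and nonprincipal: "\<exists>a. coprime a N \<and> X a = -1"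
begin

lemma mod_eq: "X (n mod N) = X n"
proof -
  have "X (k + j * N) = X k" for k j
  proof (induction j)
    case (Suc j)
    then show ?case using periodic[of "k + j * N"] by (simp add: add_ac)
  qed simp
  from this[of "n mod N" "n div N"] show ?thesis by simp
qed

text \<open>By Euler's theorem some positive power of \<open>n\<close> is congruent to
  \<open>1\<close>, where the character is \<open>1\<close>.\<close>

lemma nonzero:
  assumes "coprime n N"
  shows "X n \<noteq> 0"
proof
  assume "X n = 0"
  have "X (n ^ totient N) = X (1 mod N)"
    using euler_theorem[OF assms] mod_eq[of "n ^ totient N"] by (simp add: cong_def)
  moreover have "X (n ^ totient N) = X n * X (n ^ (totient N - 1))"
    using N_pos totient_gt_0_iff[of N] mult[of n "n ^ (totient N - 1)"]
    by (simp flip: power_Suc)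
  ultimately show False using \<open>X n = 0\<close> one mod_eq[of 1] by simp
qed

text \<open>Multiplication by \<open>a\<close> with \<open>X a = -1\<close> permutes the residues
  and changes the sign of the sum.\<close>

lemma sum_period: "(\<Sum>n<N. X n) = 0"
proof -
  obtain a where a: "coprime a N" "X a = -1" using nonprincipal by blast
  have inj: "inj_on (\<lambda>n. a * n mod N) {..<N}"
  proof (rule inj_onI)
    fix x y assume *: "x \<in> {..<N}" "y \<in> {..<N}" "a * x mod N = a * y mod N"
    then have "[a * x = a * y] (mod N)" by (simp add: cong_def)
    then have "[x = y] (mod N)" using a by (simp add: cong_mult_lcancel_nat)
    then show "x = y" using * by (simp add: cong_def)
  qed
  moreover have "(\<lambda>n. a * n mod N) ` {..<N} \<subseteq> {..<N}"
    using N_pos by auto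
  ultimately have "bij_betw (\<lambda>n. a * n mod N) {..<N} {..<N}"
    by (simp add: bij_betw_def endo_inj_surj)
  then have "(\<Sum>n<N. X (a * n mod N)) = (\<Sum>n<N. X n)"
    by (rule sum.reindex_bij_betw)
  moreover have "(\<Sum>n<N. X (a * n mod N)) = - (\<Sum>n<N. X n)"
    by (simp add: mod_eq mult a sum_negf)
  ultimately show ?thesis by simp
qed

lemma abs_le: "\<bar>X n\<bar> \<le> 1"
  using vals[of n] by auto

text \<open>Otherwise \<open>X 0 = X 0 * X n\<close> would force \<open>X\<close> to be constantly
  \<open>1\<close>, against \<open>sum_period\<close>.\<close>

lemma zero [simp]: "X 0 = 0"
proof (rule ccontr)
  assume "X 0 \<noteq> 0"
  then have "X n = 1" for n using mult[of 0 n] by simp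
  then show False using sum_period N_pos by simp
qed

lemma char_power: "X (n ^ k) = X n ^ k"
  by (induction k) (use one in \<open>simp_all add: mult\<close>)

text \<open>Whole periods contribute nothing and can be stripped off, leaving fewer than
  \<open>N\<close> terms.\<close>

lemma partial_sums_bounded: "\<bar>\<Sum>i<k. X i\<bar> \<le> N"
proof (induction k rule: less_induct)
  case (less k)
  show ?case
  proof (cases "k < N")
    case True
    have "\<bar>\<Sum>i<k. X i\<bar> \<le> (\<Sum>i<k. 1)"
      by (rule order_trans[OF sum_abs]) (intro sum_mono abs_le)
    then show ?thesis using True by simp
  next
    case False
    have "(\<Sum>i<k. X i) = (\<Sum>i<N. X i) + (\<Sum>i\<in>{N..<k}. X i)"
      using sum.atLeastLessThan_concat[of 0 N k X] False by (simp add: atLeast0LessThan)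
    also have "(\<Sum>i\<in>{N..<k}. X i) = (\<Sum>i<k - N. X (i + N))"
      using sum.shift_bounds_nat_ivl[of X 0 N "k - N"] False by (simp add: atLeast0LessThan)
    finally have "(\<Sum>i<k. X i) = (\<Sum>i<k - N. X i)"
      by (simp add: sum_period periodic)
    then show ?thesis using less[of "k - N"] N_pos False by simp
  qed
qed

text \<open>Every divisor of \<open>p ^ k * m\<close> is \<open>p ^ i * d\<close> for exactly one
  \<open>i \<le> k\<close> and one \<open>d dvd m\<close>.\<close>

lemma sum_divisors_prime_power_mult:
  assumes "prime p" "\<not> p dvd m" "m > 0"
  shows "(\<Sum>d | d dvd p ^ k * m. X d) = (\<Sum>i\<le>k. X p ^ i) * (\<Sum>d | d dvd m. X d)"
proof -
  have p0: "p > 1" using assms(1) prime_gt_1_nat by auto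
  have "(\<Sum>i\<le>k. X p ^ i) * (\<Sum>d | d dvd m. X d) = (\<Sum>(i, d)\<in>{..k} \<times> {d. d dvd m}. X (p ^ i * d))"
    by (simp add: sum_product sum.cartesian_product mult char_power case_prod_beta')
  also have "\<dots> = (\<Sum>d | d dvd p ^ k * m. X d)"
  proof -
    have "bij_betw (\<lambda>(i, d). p ^ i * d) ({..k} \<times> {d. d dvd m}) {d. d dvd p ^ k * m}"
      unfolding bij_betw_def
    proof
      show "inj_on (\<lambda>(i, d). p ^ i * d) ({..k} \<times> {d. d dvd m})"
      proof (rule inj_onI, clarify)
        fix i d j e assume *: "d dvd m" "e dvd m" "p ^ i * d = p ^ j * e"
        have nd: "\<not> p dvd d" "\<not> p dvd e" using * assms(2) by (meson dvd_trans)+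
        have "multiplicity p (p ^ i * d) = i" "multiplicity p (p ^ j * e) = j"
          using nd assms(1) p0 by (auto intro!: multiplicity_decomposeI)
        then have "i = j" using * by simp
        then show "i = j \<and> d = e" using * p0 by simp
      qed
      show "(\<lambda>(i, d). p ^ i * d) ` ({..k} \<times> {d. d dvd m}) = {d. d dvd p ^ k * m}"
      proof (intro equalityI subsetI)
        fix x assume "x \<in> {d. d dvd p ^ k * m}"
        then obtain a b where ab: "a dvd p ^ k" "b dvd m" "x = a * b"
          using division_decomp[of x "p ^ k" m] by blast
        then obtain i where "i \<le> k" "a = p ^ i"
          using divides_primepow_nat[OF assms(1)] by blast
        then show "x \<in> (\<lambda>(i, d). p ^ i * d) ` ({..k} \<times> {d. d dvd m})" using ab by auto
      qed (auto intro!: mult_dvd_mono le_imp_power_dvd)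
    qed
    from sum.reindex_bij_betw[OF this, of X] show ?thesis
      by (simp add: case_prod_beta')
  qed
  finally show ?thesis ..
qed

text \<open>Induction that strips one full prime power at a time. The local factor
  \<open>1 + X p + ... + X p ^ k\<close> is \<open>k + 1\<close>, or \<open>1\<close>, or an
  alternating sum equal to \<open>1\<close> for even \<open>k\<close> and \<open>0\<close> for odd
  \<open>k\<close>. Even multiplicity at every prime is how \<open>n\<close> being a square
  enters.\<close>

lemma sum_divisors_nonneg:
  assumes "n > 0"
  shows "(\<Sum>d | d dvd n. X d) \<ge> 0"
    and "(\<And>p. prime p \<Longrightarrow> even (multiplicity p n)) \<Longrightarrow> (\<Sum>d | d dvd n. X d) \<ge> 1"
proof -
  have "(\<Sum>d | d dvd n. X d) \<ge> 0 \<and>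
    ((\<forall>p. prime p \<longrightarrow> even (multiplicity p n)) \<longrightarrow> (\<Sum>d | d dvd n. X d) \<ge> 1)"
    using assms
  proof (induction n rule: less_induct)
    case (less n)
    show ?case
    proof (cases "n = 1")
      case True
      then show ?thesis using one by simp
    next
      case False
      then obtain p where p: "prime p" "p dvd n"
        using prime_factor_nat by blast
      define k where "k = multiplicity p n"
      obtain m where m: "n = p ^ k * m" "\<not> p dvd m"
        using multiplicity_decompose'[of n p] less p unfolding k_def by (metis not_prime_unit less_numeral_extra(3))
      have p1: "p > 1" using p prime_gt_1_nat by auto
      have "m > 0" using m less by (cases m) auto
      have "k > 0" using p less unfolding k_def by (simp add: prime_multiplicity_gt_zero_iff)
      then have "p ^ k > 1" using p1 by (rule one_less_power[rotated])
      then have "m < n" using m \<open>m > 0\<close> by simp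
      note IH = less.IH[OF \<open>m < n\<close> \<open>m > 0\<close>]
      have eq: "(\<Sum>d | d dvd n. X d) = (\<Sum>i\<le>k. X p ^ i) * (\<Sum>d | d dvd m. X d)"
        using sum_divisors_prime_power_mult[OF p(1) m(2) \<open>m > 0\<close>] m(1) by simp
      have geom: "(\<Sum>i\<le>j. X p ^ i) \<ge> 0 \<and> (even j \<longrightarrow> (\<Sum>i\<le>j. X p ^ i) \<ge> 1)" for j
      proof -
        consider "X p = 1" | "X p = 0" | "X p = -1" using vals[of p] by auto
        then show ?thesis
        proof cases
          case 3
          have "(\<Sum>i\<le>j. (-1 :: real) ^ i) = (if even j then 1 else 0)"
            by (induction j) auto
          then show ?thesis using 3 by simp
        qed (simp_all add: power_0_left)
      qed
      show ?thesis
      proof (intro conjI impI)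
        show "(\<Sum>d | d dvd n. X d) \<ge> 0" using eq geom[of k] IH by simp
        assume ev: "\<forall>q. prime q \<longrightarrow> even (multiplicity q n)"
        have "even (multiplicity q m)" if q: "prime q" for q
        proof (cases "q = p")
          case True
          then show ?thesis using m(2) by (simp add: not_dvd_imp_multiplicity_0)
        next
          case False
          then have "multiplicity q n = multiplicity q m"
            using m(1) p q \<open>m > 0\<close> p1
            by (simp add: prime_elem_multiplicity_mult_distrib multiplicity_distinct_prime_power)
          then show ?thesis using ev q by metis
        qed
        then have "1 * 1 \<le> (\<Sum>i\<le>k. X p ^ i) * (\<Sum>d | d dvd m. X d)"
          using geom[of k] IH ev p k_def by (intro mult_mono) auto
        then show "(\<Sum>d | d dvd n. X d) \<ge> 1" using eq by simp
      qed
    qed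
  qed
  then show "(\<Sum>d | d dvd n. X d) \<ge> 0"
    "(\<And>p. prime p \<Longrightarrow> even (multiplicity p n)) \<Longrightarrow> (\<Sum>d | d dvd n. X d) \<ge> 1" by auto
qed

end

section \<open>Monsky's proof that the value at 1 does not vanish\<close>

lemma geometric_mean_le_sum_powers:
  fixes x :: real
  assumes "0 < x" "x < 1"
  shows "real n * x powr ((real n - 1) / 2) \<le> (\<Sum>i<n. x ^ i)"
proof -
  define y where "y = sqrt x"
  have y: "y > 0" "x = y ^ 2" using assms by (auto simp: y_def)
  \<comment> \<open>Pair \<open>x ^ i\<close> with \<open>x ^ (n - 1 - i)\<close>: every pair has
    the same geometric mean, and the inequality of the means for two numbers applies to each
    pair.\<close>
  have "2 * real n * x powr ((real n - 1) / 2) = (\<Sum>i<n. 2 * x powr ((real n - 1) / 2))"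
    by simp
  also have "\<dots> \<le> (\<Sum>i<n. x ^ i + x ^ (n - Suc i))"
  proof (rule sum_mono)
    fix i assume i: "i \<in> {..<n}"
    have "x powr ((real n - 1) / 2) = y ^ i * y ^ (n - Suc i)"
    proof -
      have "x powr ((real n - 1) / 2) = y powr (2 * ((real n - 1) / 2))"
        using y by (simp add: powr_powr flip: powr_numeral)
      also have "2 * ((real n - 1) / 2) = real (i + (n - Suc i))"
        using i by (simp add: of_nat_diff)
      also have "y powr \<dots> = y ^ (i + (n - Suc i))"
        using y(1) by (rule powr_realpow)
      finally show ?thesis by (simp add: power_add)
    qed
    moreover have "0 \<le> (y ^ i - y ^ (n - Suc i))\<^sup>2" by simp
    ultimately show "2 * x powr ((real n - 1) / 2) \<le> x ^ i + x ^ (n - Suc i)"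
      by (simp add: y(2) power2_diff flip: power_mult) (simp add: mult_ac)
  qed
  also have "\<dots> = 2 * (\<Sum>i<n. x ^ i)"
    using sum.nat_diff_reindex[of "\<lambda>i. x ^ i" n] by (simp add: sum.distrib)
  finally show ?thesis by simp
qed

text \<open>Both factors of \<open>(1 + \<dots> + x\<^bsup>n-1\<^esup>)(1 + \<dots> + x\<^sup>n)\<close> dominate their geometric means.\<close>

lemma monsky_sequence_decreasing:
  fixes x :: real
  assumes "0 < x" "x < 1" "n \<ge> 1"
  defines "b \<equiv> \<lambda>n. 1 / (real n * (1 - x)) - x ^ n / (1 - x ^ n)"
  shows "b (Suc n) \<le> b n"
proof -
  \<comment> \<open>Since \<open>1 - x ^ n = (1 - x) * G n\<close>, the factor \<open>1 - x\<close>
    cancels, and the claim is that \<open>x ^ n / G n\<close> drops by at most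
    \<open>1 / n - 1 / (n + 1)\<close> at each step.\<close>
  define G where "G n = (\<Sum>i<n. x ^ i)" for n
  have G: "1 - x ^ n = (1 - x) * G n" for n
    by (simp add: G_def one_diff_power_eq)
  have Gpos: "G n > 0" if "n \<ge> 1" for n
    unfolding G_def using that assms by (intro sum_pos) (auto simp: lessThan_empty_iff)
  have "real n * real (Suc n) * x ^ n \<le> (real n * x powr ((real n - 1) / 2)) * (real (Suc n) * x powr (real n / 2))"
  proof -
    \<comment> \<open>The two exponents add up to \<open>n - 1/2\<close>, and powers of
      \<open>x < 1\<close> decrease in the exponent.\<close>
    have "x ^ n = x powr (real n)" using assms by (simp add: powr_realpow)
    also have "\<dots> \<le> x powr ((real n - 1) / 2 + real n / 2)"
      using assms by (intro powr_mono') (auto simp: field_simps)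
    also have "\<dots> = x powr ((real n - 1) / 2) * x powr (real n / 2)" by (simp add: powr_add)
    finally have "(real n * real (Suc n)) * x ^ n \<le> (real n * real (Suc n)) * (x powr ((real n - 1) / 2) * x powr (real n / 2))"
      by (rule mult_left_mono) simp
    then show ?thesis by (simp only: mult_ac)
  qed
  also have "\<dots> \<le> G n * G (Suc n)"
    using geometric_mean_le_sum_powers[OF assms(1,2), of n] geometric_mean_le_sum_powers[OF assms(1,2), of "Suc n"]
    unfolding G_def by (intro mult_mono) (use assms in \<open>auto intro!: sum_nonneg\<close>)
  finally have key: "real n * real (Suc n) * x ^ n \<le> G n * G (Suc n)" .
  have GS: "G (Suc n) = 1 + x * G n"
    unfolding G_def by (simp only: sum.lessThan_Suc_shift sum_distrib_left power_0 power_Suc)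
  have *: "x ^ n / G n - x ^ Suc n / G (Suc n) = x ^ n / (G n * G (Suc n))"
  proof -
    have "x ^ n / G n - x ^ Suc n / G (Suc n) = x ^ n * (G (Suc n) - x * G n) / (G n * G (Suc n))"
      using Gpos[of n] Gpos[of "Suc n"] assms by (simp add: field_simps)
    also have "G (Suc n) - x * G n = 1" using GS by simp
    finally show ?thesis by simp
  qed
  have "x ^ n / (G n * G (Suc n)) \<le> 1 / (real n * real (Suc n))"
  proof -
    have "u / A \<le> 1 / B" if "B * u \<le> A" "A > 0" "B > 0" for u A B :: real
      using that by (simp add: field_simps)
    from this[OF key] show ?thesis
      using Gpos[of n] Gpos[of "Suc n"] assms by simp
  qed
  also have "\<dots> = 1 / real n - 1 / real (Suc n)"
    using assms by (simp add: field_simps)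
  finally have "1 / real (Suc n) - x ^ Suc n / G (Suc n) \<le> 1 / real n - x ^ n / G n"
    using * by linarith
  then have "(1 / real (Suc n) - x ^ Suc n / G (Suc n)) / (1 - x) \<le> (1 / real n - x ^ n / G n) / (1 - x)"
    by (rule divide_right_mono) (use assms in simp)
  then show ?thesis unfolding b_def G
    by (simp add: diff_divide_distrib mult.commute)
qed

context real_character
begin

text \<open>Each \<open>x ^ n / (1 - x ^ n)\<close> is the geometric series of
  \<open>(x ^ n) ^ k\<close> over \<open>k \<ge> 1\<close>; the double series converges absolutely
  and is regrouped by the exponent \<open>n * k\<close>.\<close>

lemma lambert_series:
  fixes x :: real
  assumes x: "0 < x" "x < 1"
  shows "(\<lambda>n. X n * (x ^ n / (1 - x ^ n))) sums (\<Sum>\<^sub>\<infinity>n\<in>{1..}. (\<Sum>d | d dvd n. X d) * x ^ n)"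
    and "(\<lambda>n. (\<Sum>d | d dvd n. X d) * x ^ n) summable_on {1..}"
proof -
  have xn: "x ^ n < 1" "x ^ n > 0" if "n \<ge> 1" for n
    using that x by (auto simp: power_less_one_iff)
  have geo: "((\<lambda>k. (x ^ n) ^ k) has_sum (x ^ n / (1 - x ^ n))) {1..}" if "n \<ge> 1" for n
  proof -
    have "(\<lambda>k. (x ^ n) ^ Suc k) sums (x ^ n / (1 - x ^ n))"
      using sums_mult[OF geometric_sums[of "x ^ n"], of "x ^ n"] xn[OF that] by simp
    then have "((\<lambda>k. (x ^ n) ^ Suc k) has_sum (x ^ n / (1 - x ^ n))) UNIV"
      by (rule sums_nonneg_imp_has_sum) (use x in auto)
    moreover have "bij_betw Suc UNIV {1..}"
      by (rule bij_betwI[where g = "\<lambda>n. n - 1"]) auto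
    ultimately show ?thesis
      using has_sum_reindex_bij_betw[of Suc UNIV "{1..}" "\<lambda>k. (x ^ n) ^ k"] by simp
  qed
  have le: "x ^ n / (1 - x ^ n) \<le> x ^ n / (1 - x)" if "n \<ge> 1" for n
    using that x power_decreasing[of 1 n x] by (intro divide_left_mono mult_pos_pos) (auto simp: power_less_one_iff)
  have "summable (\<lambda>n. x ^ n / (1 - x))"
    using x by (intro summable_divide summable_geometric) auto
  then have gsum: "(\<lambda>n. x ^ n / (1 - x)) summable_on UNIV"
    using x by (subst summable_on_UNIV_nonneg_real_iff) auto
  then have gsum1: "(\<lambda>n. x ^ n / (1 - x)) summable_on {1..}"
    by (rule summable_on_subset_banach) auto
  have nn: "(\<lambda>n. x ^ n / (1 - x ^ n)) summable_on {1..}"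
    by (rule summable_on_comparison_test[OF gsum1]) (use le xn in \<open>auto intro!: divide_nonneg_nonneg simp: less_imp_le\<close>)
  have pos: "(\<lambda>(n, k). (x ^ n) ^ k) summable_on {1..} \<times> {1..}"
    by (rule summable_on_SigmaI[OF _ nn]) (use geo x in auto)
  have sm: "(\<lambda>(n, k). X n * (x ^ n) ^ k) summable_on {1..} \<times> {1..}"
    by (rule abs_summable_summable[OF Infinite_Sum.abs_summable_on_comparison_test'[OF pos]])
       (use abs_le x in \<open>auto simp: abs_mult intro!: mult_left_le_one_le\<close>)
  have eq: "(\<Sum>d | d dvd n. X d * (x ^ d) ^ (n div d)) = (\<Sum>d | d dvd n. X d) * x ^ n" for n
    by (auto simp: sum_distrib_right simp flip: power_mult intro!: sum.cong)
  show "(\<lambda>n. (\<Sum>d | d dvd n. X d) * x ^ n) summable_on {1..}"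
    using infsum_divisor_pairs(2)[OF sm] by (simp add: eq)
  have inner: "(\<Sum>\<^sub>\<infinity>k\<in>{1..}. X n * (x ^ n) ^ k) = X n * (x ^ n / (1 - x ^ n))" if "n \<in> {1..}" for n
    using that by (intro infsumI has_sum_cmult_right geo) auto
  have "(\<Sum>\<^sub>\<infinity>n\<in>{1..}. (\<Sum>d | d dvd n. X d) * x ^ n) = (\<Sum>\<^sub>\<infinity>n\<in>{1..}. \<Sum>\<^sub>\<infinity>k\<in>{1..}. X n * (x ^ n) ^ k)"
    using infsum_divisor_pairs(1)[OF sm] by (simp add: eq)
  also have "\<dots> = (\<Sum>\<^sub>\<infinity>n\<in>{1..}. X n * (x ^ n / (1 - x ^ n)))"
    by (intro infsum_cong inner)
  \<comment> \<open>The index \<open>0\<close> may be added because \<open>X 0 = 0\<close>.\<close>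
  also have "\<dots> = (\<Sum>\<^sub>\<infinity>n. X n * (x ^ n / (1 - x ^ n)))"
    by (intro infsum_cong_neutral) (auto simp: not_le)
  finally have inf: "(\<Sum>\<^sub>\<infinity>n\<in>{1..}. (\<Sum>d | d dvd n. X d) * x ^ n) = (\<Sum>\<^sub>\<infinity>n. X n * (x ^ n / (1 - x ^ n)))" .
  have "(\<lambda>n. X n * (x ^ n / (1 - x ^ n))) summable_on UNIV"
  proof (rule abs_summable_summable, rule Infinite_Sum.abs_summable_on_comparison_test'[OF gsum])
    fix n :: nat
    show "norm (X n * (x ^ n / (1 - x ^ n))) \<le> x ^ n / (1 - x)"
    proof (cases "n = 0")
      case False
      then have "\<bar>X n\<bar> * (x ^ n / (1 - x ^ n)) \<le> 1 * (x ^ n / (1 - x))"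
        using abs_le[of n] le[of n] xn[of n] by (intro mult_mono) auto
      then show ?thesis using xn[of n] False by (simp add: abs_mult)
    qed (use x in simp)
  qed
  then show "(\<lambda>n. X n * (x ^ n / (1 - x ^ n))) sums (\<Sum>\<^sub>\<infinity>n\<in>{1..}. (\<Sum>d | d dvd n. X d) * x ^ n)"
    unfolding inf by (intro has_sum_imp_sums has_sum_infsum)
qed

lemma summable_L1: "summable (\<lambda>n. X n / real n)"
proof -
  have "summable (\<lambda>n. X n * (1 / real n))"
  proof (rule dirichlet_test[of X _ 1])
    show "(\<lambda>n. 1 / real n) \<longlonglongrightarrow> 0" by (rule lim_1_over_n)
  qed (use partial_sums_bounded in \<open>auto simp: field_simps\<close>)
  then show ?thesis by simp
qed

lemma L1_nonzero: "(\<Sum>n. X n / real n) \<noteq> 0"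
proof
  assume L0: "(\<Sum>n. X n / real n) = 0"
  define F where "F n = (\<Sum>d | d dvd n. X d)" for n
  have bound: "(\<Sum>m<K. x ^ (Suc m)\<^sup>2) \<le> 2 * real N" if x: "0 < x" "x < 1" for x K
  proof -
    \<comment> \<open>By \<open>L0\<close> the series of \<open>X n / n / (1 - x)\<close> sums to
      \<open>0\<close>, so replacing the Lambert terms by \<open>b n\<close> only flips the sign of
      the sum. The gain is that \<open>b\<close> decreases to \<open>0\<close> from
      \<open>b 1 = 1\<close>, so Dirichlet's test gives a bound independent of
      \<open>x\<close>.\<close>
    define b where "b n = 1 / (real n * (1 - x)) - x ^ n / (1 - x ^ n)" for n
    have "(\<lambda>n. 1 / real n / (1 - x) - x ^ n / (1 - x ^ n)) \<longlonglongrightarrow> 0 / (1 - x) - 0 / (1 - 0)"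
      using x by (intro tendsto_intros lim_1_over_n LIMSEQ_power_zero) auto
    then have blim: "b \<longlonglongrightarrow> 0" unfolding b_def by simp
    note dt = dirichlet_test[of X "real N" 1 b, OF partial_sums_bounded _ blim]
    have dec: "b (Suc n) \<le> b n" if "n \<ge> 1" for n
      using monsky_sequence_decreasing[OF x that] unfolding b_def .
    have sumXb: "\<bar>\<Sum>n. X n * b n\<bar> \<le> 2 * real N * b 1"
      using dt(2)[OF dec] by simp
    have "(\<lambda>n. X n / real n / (1 - x) - X n * (x ^ n / (1 - x ^ n))) sums (0 / (1 - x) - (\<Sum>\<^sub>\<infinity>n\<in>{1..}. F n * x ^ n))"
      unfolding F_def using summable_L1 L0 lambert_series(1)[OF x]
      by (intro sums_diff sums_divide) (auto simp: sums_iff)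
    then have "(\<lambda>n. X n * b n) sums (- (\<Sum>\<^sub>\<infinity>n\<in>{1..}. F n * x ^ n))"
      by (simp add: b_def algebra_simps)
    then have "\<bar>\<Sum>\<^sub>\<infinity>n\<in>{1..}. F n * x ^ n\<bar> \<le> 2 * real N * b 1"
      using sumXb by (simp add: sums_iff)
    also have "b 1 = 1" using x by (simp add: b_def flip: diff_divide_distrib)
    finally have up: "(\<Sum>\<^sub>\<infinity>n\<in>{1..}. F n * x ^ n) \<le> 2 * real N" by simp
    have "(\<Sum>m<K. x ^ (Suc m)\<^sup>2) \<le> (\<Sum>m<K. F ((Suc m)\<^sup>2) * x ^ (Suc m)\<^sup>2)"
    proof (rule sum_mono)
      fix m
      have "F ((Suc m)\<^sup>2) \<ge> 1"
        unfolding F_def by (rule sum_divisors_nonneg) (auto simp: prime_elem_multiplicity_power_distrib)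
      then show "x ^ (Suc m)\<^sup>2 \<le> F ((Suc m)\<^sup>2) * x ^ (Suc m)\<^sup>2" using x by simp
    qed
    also have "\<dots> = (\<Sum>n\<in>(\<lambda>m. (Suc m)\<^sup>2) ` {..<K}. F n * x ^ n)"
      by (subst sum.reindex) (auto intro!: inj_onI)
    also have "\<dots> \<le> (\<Sum>\<^sub>\<infinity>n\<in>{1..}. F n * x ^ n)"
      unfolding F_def using x sum_divisors_nonneg(1)
      by (intro finite_sum_le_infsum lambert_series) (auto intro!: mult_nonneg_nonneg)
    finally show ?thesis using up by linarith
  qed
  \<comment> \<open>Let \<open>x\<close> tend to \<open>1\<close> from the left with the number
    \<open>K\<close> of squares fixed; then \<open>K\<close> may be chosen larger than the
    bound.\<close>
  have "real K \<le> 2 * real N" for K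
  proof -
    have "((\<lambda>x. \<Sum>m<K. x ^ (Suc m)\<^sup>2) \<longlongrightarrow> (\<Sum>m<K. 1 ^ (Suc m)\<^sup>2)) (at_left (1::real))"
      by (intro tendsto_intros)
    moreover have "eventually (\<lambda>x. (\<Sum>m<K. x ^ (Suc m)\<^sup>2) \<le> 2 * real N) (at_left (1::real))"
      using eventually_at_left_real[of 0 1] bound by (auto elim!: eventually_mono)
    ultimately show ?thesis by (intro tendsto_upperbound) auto
  qed
  from this[of "2 * N + 1"] show False by simp
qed

end

section \<open>Primes with prescribed real characters\<close>

text \<open>The product is non-principal because the Chinese remainder theorem provides a residue at
  which \<open>X\<close> is \<open>-1\<close> and \<open>Y\<close> is \<open>1\<close>; this is
  where coprime moduli enter.\<close>

lemma real_character_mult: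
  assumes "real_character X M" "real_character Y N" "coprime M N"
  shows "real_character (\<lambda>n. X n * Y n) (M * N)"
proof -
  interpret X: real_character X M by fact
  interpret Y: real_character Y N by fact
  show ?thesis
  proof
    show "X n * Y n \<in> {-1, 0, 1}" for n using X.vals[of n] Y.vals[of n] by auto
    show "X (n + M * N) * Y (n + M * N) = X n * Y n" for n
      using X.mod_eq[of "n + M * N"] X.mod_eq[of n] Y.mod_eq[of "n + M * N"] Y.mod_eq[of n] by simp
    obtain a where a: "coprime a M" "X a = -1" using X.nonprincipal by blast
    obtain b where b: "[b = a] (mod M)" "[b = 1] (mod N)"
      using binary_chinese_remainder_nat[OF assms(3)] by blast
    have "coprime b M" "coprime b N" 
      using a(1) cong_imp_coprime[OF cong_sym[OF b(1)]] cong_imp_coprime[OF cong_sym[OF b(2)]] by simp_all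
    moreover have "X b = -1" using a(2) b(1) X.mod_eq by (metis cong_def)
    moreover have "Y b = 1" using Y.one b(2) Y.mod_eq by (metis cong_def)
    ultimately show "\<exists>a. coprime a (M * N) \<and> X a * Y a = -1" by (intro exI[of _ b]) auto
  qed (use X.mult Y.mult X.one Y.one X.N_pos Y.N_pos in auto)
qed

lemma real_character_prod:
  assumes "finite S" "S \<noteq> {}" "\<And>i. i \<in> S \<Longrightarrow> real_character (X i) (m i)"
    and "\<And>i j. i \<in> S \<Longrightarrow> j \<in> S \<Longrightarrow> i \<noteq> j \<Longrightarrow> coprime (m i) (m j)"
  shows "real_character (\<lambda>n. \<Prod>i\<in>S. X i n) (\<Prod>i\<in>S. m i)"
  using assms
proof (induction S rule: finite_ne_induct)
  case (insert i S)
  have "real_character (\<lambda>n. X i n * (\<Prod>i\<in>S. X i n)) (m i * (\<Prod>i\<in>S. m i))"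
  proof (rule real_character_mult)
    show "coprime (m i) (\<Prod>i\<in>S. m i)"
      using insert by (intro prod_coprime_right) auto
  qed (use insert in auto)
  then show ?case using insert by simp
qed simp

section \<open>Dirichlet series to the right of s = 1\<close>

lemma summable_on_ln_powr:
  assumes "s > 1"
  shows "(\<lambda>n::nat. ln (real n) * real n powr - s) summable_on {1..}"
proof (rule summable_on_comparison_test)
  \<comment> \<open>Half of the excess \<open>s - 1\<close> absorbs the logarithm; the remaining
    exponent \<open>a - s\<close> is still below \<open>-1\<close>.\<close>
  define a where "a = (s - 1) / 2"
  have a: "a > 0" using assms by (simp add: a_def)
  have "summable (\<lambda>n::nat. real n powr (a - s) / a)"
    using assms by (intro summable_divide) (simp add: summable_real_powr_iff a_def field_simps)
  then have "(\<lambda>n::nat. real n powr (a - s) / a) summable_on UNIV"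
    using a by (subst summable_on_UNIV_nonneg_real_iff) auto
  then show "(\<lambda>n::nat. real n powr (a - s) / a) summable_on {1..}"
    by (rule summable_on_subset_banach) auto
  fix n :: nat assume n: "n \<in> {1..}"
  have "ln (real n) * real n powr - s \<le> (real n powr a / a) * real n powr - s"
    using ln_powr_bound[of "real n" a] a n by (intro mult_right_mono) auto
  then show "ln (real n) * real n powr - s \<le> real n powr (a - s) / a"
    by (simp add: powr_diff powr_minus field_simps)
qed auto

lemma summable_on_powr:
  assumes "s > 1"
  shows "(\<lambda>n::nat. real n powr - s) summable_on {1..}"
proof -
  have "(\<lambda>n::nat. real n powr - s) summable_on UNIV"
    using assms by (subst summable_on_UNIV_nonneg_real_iff) (auto simp: summable_real_powr_iff)
  then show ?thesis by (rule summable_on_subset_banach) auto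
qed

lemma summable_on_bounded_mult:
  fixes f g :: "'a \<Rightarrow> real"
  assumes "g summable_on A" "\<And>x. x \<in> A \<Longrightarrow> \<bar>f x\<bar> \<le> C" "\<And>x. x \<in> A \<Longrightarrow> g x \<ge> 0"
  shows "(\<lambda>x. f x * g x) summable_on A"
proof (rule abs_summable_summable, rule Infinite_Sum.abs_summable_on_comparison_test')
  show "(\<lambda>x. C * g x) summable_on A" using assms(1) by (rule summable_on_cmult_right)
  fix x assume "x \<in> A"
  then show "norm (f x * g x) \<le> C * g x"
    using assms(2,3)[of x] by (simp add: abs_mult mult_right_mono)
qed

lemma summable_on_mangoldt_powr:
  assumes "s > 1"
  shows "(\<lambda>n::nat. mangoldt n * real n powr - s) summable_on {1..}"
  by (rule summable_on_comparison_test[OF summable_on_ln_powr[OF assms]])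
     (simp_all add: mult_right_mono mangoldt_le mangoldt_nonneg)

text \<open>The identity \<open>-L' = (-L'/L) * L\<close> for the Dirichlet series \<open>L\<close>
  of \<open>X\<close>, obtained without differentiation from the fact that \<open>mangoldt\<close>
  summed over the divisors of \<open>n\<close> is \<open>ln n\<close>. The constant
  \<open>X = 1\<close> is allowed and gives the case of zeta.\<close>

lemma mangoldt_convolution:
  fixes X :: "nat \<Rightarrow> real"
  assumes mult: "\<And>m n. X (m * n) = X m * X n" and le: "\<And>n. \<bar>X n\<bar> \<le> 1" and s: "s > 1"
  shows "(\<Sum>\<^sub>\<infinity>n\<in>{1..}. X n * (ln (real n) * real n powr - s))
       = (\<Sum>\<^sub>\<infinity>n\<in>{1..}. X n * (mangoldt n * real n powr - s)) * (\<Sum>\<^sub>\<infinity>n\<in>{1..}. X n * real n powr - s)"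
proof -
  define f where "f n = X n * (mangoldt n * real n powr - s)" for n
  define g where "g n = X n * real n powr - s" for n
  have f: "f summable_on {1..}" unfolding f_def
    by (rule summable_on_bounded_mult[OF summable_on_mangoldt_powr[OF s], where C = 1])
       (use le in \<open>auto intro!: mult_nonneg_nonneg mangoldt_nonneg\<close>)
  have g: "g summable_on {1..}" unfolding g_def
    by (rule summable_on_bounded_mult[OF summable_on_powr[OF s], where C = 1]) (use le in auto)
  have fg: "(\<lambda>n. \<bar>f n\<bar>) summable_on {1..}" "(\<lambda>n. \<bar>g n\<bar>) summable_on {1..}"
    using f g summable_on_iff_abs_summable_on_real[of f] summable_on_iff_abs_summable_on_real[of g] by simp_all
  have "(\<lambda>(d, e). \<bar>f d\<bar> * \<bar>g e\<bar>) summable_on {1..} \<times> {1..}"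
  proof (rule summable_on_SigmaI)
    show "((\<lambda>e. case (d, e) of (d, e) \<Rightarrow> \<bar>f d\<bar> * \<bar>g e\<bar>) has_sum (\<bar>f d\<bar> * (\<Sum>\<^sub>\<infinity>e\<in>{1..}. \<bar>g e\<bar>))) {1..}" for d
      using has_sum_cmult_right[OF has_sum_infsum[OF fg(2)], of "\<bar>f d\<bar>"] by simp
    show "(\<lambda>d. \<bar>f d\<bar> * (\<Sum>\<^sub>\<infinity>e\<in>{1..}. \<bar>g e\<bar>)) summable_on {1..}"
      using fg(1) by (rule summable_on_cmult_left)
  qed auto
  then have "(\<lambda>(d, e). f d * g e) summable_on {1..} \<times> {1..}"
    using abs_summable_summable[of "\<lambda>(d, e). f d * g e"] by (simp add: case_prod_beta' abs_mult)
  from infsum_divisor_pairs(1)[OF this]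
  have "(\<Sum>\<^sub>\<infinity>d\<in>{1..}. \<Sum>\<^sub>\<infinity>e\<in>{1..}. f d * g e) = (\<Sum>\<^sub>\<infinity>n\<in>{1..}. \<Sum>d | d dvd n. f d * g (n div d))" .
  also have "(\<Sum>\<^sub>\<infinity>d\<in>{1..}. \<Sum>\<^sub>\<infinity>e\<in>{1..}. f d * g e) = (\<Sum>\<^sub>\<infinity>d\<in>{1..}. f d) * (\<Sum>\<^sub>\<infinity>e\<in>{1..}. g e)"
    by (simp add: infsum_cmult_right' infsum_cmult_left')
  also have "(\<Sum>\<^sub>\<infinity>n\<in>{1..}. \<Sum>d | d dvd n. f d * g (n div d)) = (\<Sum>\<^sub>\<infinity>n\<in>{1..}. X n * (ln (real n) * real n powr - s))"
  proof (rule infsum_cong)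
    fix n :: nat assume n: "n \<in> {1..}"
    have "(\<Sum>d | d dvd n. f d * g (n div d)) = (\<Sum>d | d dvd n. mangoldt d * (X n * real n powr - s))"
    proof (rule sum.cong)
      fix d assume "d \<in> {d. d dvd n}"
      then obtain e where e: "n = d * e" by auto
      with n have "d > 0" by (cases d) auto
      then show "f d * g (n div d) = mangoldt d * (X n * real n powr - s)"
        unfolding f_def g_def e by (simp add: mult powr_mult)
    qed simp
    also have "\<dots> = (\<Sum>d | d dvd n. mangoldt d) * (X n * real n powr - s)"
      by (simp add: sum_distrib_right)
    also have "(\<Sum>d | d dvd n. mangoldt d) = ln (real n)"
      using mangoldt_sum[of n, where ?'a = real] n by simp
    finally show "(\<Sum>d | d dvd n. f d * g (n div d)) = X n * (ln (real n) * real n powr - s)" by simp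
  qed
  finally show ?thesis unfolding f_def g_def by simp
qed

text \<open>Split off \<open>ln x / x\<close>, which decreases from \<open>exp 1\<close> on;
  \<open>3\<close> is the first integer beyond that.\<close>

lemma ln_powr_decreasing:
  fixes x y s :: real
  assumes "3 \<le> x" "x \<le> y" "s \<ge> 1"
  shows "ln y * y powr - s \<le> ln x * x powr - s"
proof -
  have "exp 1 \<le> x" using exp_le assms by linarith
  then have "ln y / y \<le> ln x / x" using assms by (intro ln_x_over_x_mono)
  moreover have "y powr (1 - s) \<le> x powr (1 - s)" using assms by (intro powr_mono2') auto
  ultimately have "ln y / y * y powr (1 - s) \<le> ln x / x * x powr (1 - s)"
    using assms by (intro mult_mono) auto
  then show ?thesis using assms by (simp add: powr_diff powr_minus field_simps)
qed

lemma ln_powr_tendsto_0: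
  assumes "s > 1"
  shows "(\<lambda>n::nat. ln (real n) * real n powr - s) \<longlonglongrightarrow> 0"
proof -
  have "(\<lambda>n::nat. ln (real n) * real n powr - s) summable_on UNIV"
    using summable_on_ln_powr[OF assms]
    by (rule summable_on_cong_neutral[THEN iffD1, rotated -1]) (auto simp: not_le)
  then show ?thesis by (intro summable_LIMSEQ_zero summable_on_imp_summable)
qed

context real_character
begin

lemma infsum_eq_suminf:
  assumes "(\<lambda>n. X n * f n) summable_on {1..}"
  shows "(\<Sum>\<^sub>\<infinity>n\<in>{1..}. X n * f n) = (\<Sum>n. X n * f n)"
proof -
  have "((\<lambda>n. X n * f n) has_sum (\<Sum>\<^sub>\<infinity>n\<in>{1..}. X n * f n)) {1..}"
    using assms by (rule has_sum_infsum)
  then have "((\<lambda>n. X n * f n) has_sum (\<Sum>\<^sub>\<infinity>n\<in>{1..}. X n * f n)) UNIV"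
    by (rule has_sum_cong_neutral[THEN iffD1, rotated -1]) (auto simp: not_le)
  then show ?thesis by (simp add: has_sum_imp_sums sums_unique)
qed

text \<open>Takes the place of continuity at \<open>1\<close>: the tails from \<open>M\<close> on
  are small uniformly in \<open>s \<ge> 1\<close>, and the head is a finite sum. The two tails and
  the change of the head cost at most an eighth of \<open>\<bar>L\<bar>\<close> each, which leaves
  more than half.\<close>

lemma L_bounded_away:
  "eventually (\<lambda>s. \<bar>\<Sum>\<^sub>\<infinity>n\<in>{1..}. X n * real n powr - s\<bar> \<ge> \<bar>\<Sum>n. X n / real n\<bar> / 2) (at_right 1)"
proof -
  define L where "L = (\<Sum>n. X n / real n)"
  have L: "\<bar>L\<bar> > 0" using L1_nonzero by (simp add: L_def)
  \<comment> \<open>Chosen to make the tail bound \<open>2 * N / M\<close> at most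
    \<open>\<bar>L\<bar> / 8\<close>.\<close>
  obtain M :: nat where M: "real M > 16 * real N / \<bar>L\<bar>" using reals_Archimedean2 by blast
  have "16 * real N / \<bar>L\<bar> \<ge> 0" by simp
  then have "real M > 0" using M by linarith
  then have M0: "M > 0" by simp
  have tail: "\<bar>(\<Sum>n. X n * real n powr - s) - (\<Sum>n<M. X n * real n powr - s)\<bar> \<le> \<bar>L\<bar> / 8" if "s \<ge> 1" for s
  proof -
    have "\<bar>(\<Sum>n. X n * real n powr - s) - (\<Sum>n<M. X n * real n powr - s)\<bar> \<le> 2 * real N * real M powr - s"
    proof (rule dirichlet_test)
      show "(\<lambda>n. real n powr - s) \<longlonglongrightarrow> 0"
        using that by (intro tendsto_neg_powr filterlim_real_sequentially) auto
      show "real (Suc n) powr - s \<le> real n powr - s" if "n \<ge> M" for n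
        using that M0 \<open>s \<ge> 1\<close> by (intro powr_mono2') auto
    qed (rule partial_sums_bounded)
    also have "\<dots> \<le> 2 * real N * real M powr - 1"
      using that M0 by (intro mult_left_mono powr_mono) auto
    also have "\<dots> \<le> \<bar>L\<bar> / 8" using M M0 L by (simp add: powr_minus field_simps)
    finally show ?thesis .
  qed
  have "((\<lambda>s. \<Sum>n<M. X n * real n powr - s) \<longlongrightarrow> (\<Sum>n<M. X n * real n powr - 1)) (at_right 1)"
  proof (rule tendsto_sum)
    fix n show "((\<lambda>s. X n * real n powr - s) \<longlongrightarrow> X n * real n powr - 1) (at_right 1)"
      by (cases "n = 0") (simp, intro tendsto_intros, auto)
  qed
  then have "eventually (\<lambda>s. dist (\<Sum>n<M. X n * real n powr - s) (\<Sum>n<M. X n * real n powr - 1) < \<bar>L\<bar> / 8) (at_right 1)"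
    using L by (intro tendstoD) auto
  moreover have "eventually (\<lambda>s::real. s > 1) (at_right 1)" by (rule eventually_at_right_less)
  ultimately show ?thesis
  proof eventually_elim
    case (elim s)
    have "(\<Sum>n. X n * real n powr - 1) = L" unfolding L_def
      by (simp add: powr_minus divide_inverse)
    moreover have "(\<Sum>\<^sub>\<infinity>n\<in>{1..}. X n * real n powr - s) = (\<Sum>n. X n * real n powr - s)"
      by (intro infsum_eq_suminf summable_on_bounded_mult[OF summable_on_powr, where C = 1])
         (use elim abs_le in auto)
    ultimately show ?case
      using tail[of 1] tail[of s] elim unfolding L_def[symmetric] dist_real_def by linarith
  qed
qed

text \<open>The series is \<open>-L'(s) / L(s)\<close>: the numerator is bounded uniformly in
  \<open>s\<close> by Dirichlet's test, and the denominator stays away from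
  \<open>0\<close>.\<close>

lemma mangoldt_series_bounded:
  "\<exists>C. eventually (\<lambda>s. \<bar>\<Sum>\<^sub>\<infinity>n\<in>{1..}. X n * (mangoldt n * real n powr - s)\<bar> \<le> C) (at_right 1)"
proof -
  define L where "L = (\<Sum>n. X n / real n)"
  have L: "\<bar>L\<bar> > 0" using L1_nonzero by (simp add: L_def)
  \<comment> \<open>The terms at \<open>0\<close> and \<open>1\<close> vanish, the term at
    \<open>2\<close> is at most \<open>ln 2\<close>, and the tail from \<open>3\<close> on is
    covered by Dirichlet's test.\<close>
  define D where "D = ln 2 + 2 * real N * ln 3"
  have "eventually (\<lambda>s::real. s > 1) (at_right 1)" by (rule eventually_at_right_less)
  with L_bounded_away
  have "eventually (\<lambda>s. \<bar>\<Sum>\<^sub>\<infinity>n\<in>{1..}. X n * (mangoldt n * real n powr - s)\<bar> \<le> D / (\<bar>L\<bar> / 2)) (at_right 1)"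
  proof eventually_elim
    case (elim s)
    define a where "a n = ln (real n) * real n powr - s" for n
    have "\<bar>(\<Sum>n. X n * a n) - (\<Sum>n<3. X n * a n)\<bar> \<le> 2 * real N * a 3"
    proof (rule dirichlet_test)
      show "a \<longlonglongrightarrow> 0" unfolding a_def using elim by (intro ln_powr_tendsto_0)
      show "a (Suc n) \<le> a n" if "n \<ge> 3" for n
        unfolding a_def using that elim by (intro ln_powr_decreasing) auto
    qed (rule partial_sums_bounded)
    moreover have "a 3 \<le> ln 3"
      using powr_mono[of "-s" 0 3] elim unfolding a_def by (simp add: mult_left_le)
    then have "2 * real N * a 3 \<le> 2 * real N * ln 3" by (intro mult_left_mono) auto
    moreover have "\<bar>\<Sum>n<3. X n * a n\<bar> \<le> ln 2"
    proof -
      have "(\<Sum>n<3. X n * a n) = X 2 * a 2" by (simp add: eval_nat_numeral a_def)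
      moreover have "\<bar>a 2\<bar> \<le> ln 2"
        using powr_mono[of "-s" 0 2] elim unfolding a_def by (simp add: abs_mult mult_left_le)
      ultimately show ?thesis
        using mult_mono[OF abs_le[of 2] \<open>\<bar>a 2\<bar> \<le> ln 2\<close>] by (simp add: abs_mult)
    qed
    ultimately have "\<bar>\<Sum>n. X n * a n\<bar> \<le> D" unfolding D_def by linarith
    moreover have "(\<Sum>\<^sub>\<infinity>n\<in>{1..}. X n * a n) = (\<Sum>n. X n * a n)" unfolding a_def
      by (intro infsum_eq_suminf summable_on_bounded_mult[OF summable_on_ln_powr, where C = 1])
         (use elim abs_le in auto)
    moreover note mangoldt_convolution[of X s, OF mult abs_le elim(2)]
    ultimately have "\<bar>\<Sum>\<^sub>\<infinity>n\<in>{1..}. X n * (mangoldt n * real n powr - s)\<bar> * \<bar>\<Sum>\<^sub>\<infinity>n\<in>{1..}. X n * real n powr - s\<bar> \<le> D"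
      unfolding a_def by (simp add: abs_mult)
    moreover have "\<bar>\<Sum>\<^sub>\<infinity>n\<in>{1..}. X n * (mangoldt n * real n powr - s)\<bar> * (\<bar>L\<bar> / 2)
       \<le> \<bar>\<Sum>\<^sub>\<infinity>n\<in>{1..}. X n * (mangoldt n * real n powr - s)\<bar> * \<bar>\<Sum>\<^sub>\<infinity>n\<in>{1..}. X n * real n powr - s\<bar>"
      using elim(1) unfolding L_def by (intro mult_left_mono) auto
    ultimately show ?case using L by (subst pos_le_divide_eq) auto
  qed
  then show ?thesis by blast
qed

end

section \<open>Divergence at s = 1 for the trivial character\<close>

lemma zeta_at_top: "filterlim (\<lambda>s. \<Sum>\<^sub>\<infinity>n\<in>{1::nat..}. real n powr - s) at_top (at_right 1)"
  unfolding filterlim_at_top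
proof
  fix K :: real
  \<comment> \<open>The harmonic series has a finite partial sum above \<open>K + 1\<close>; being
    continuous in \<open>s\<close>, that sum stays above \<open>K\<close> just to the right of
    \<open>1\<close>.\<close>
  have "\<not> summable (\<lambda>n::nat. real n powr - 1)"
    by (subst summable_real_powr_iff) simp
  then have "\<not> (\<forall>M. (\<Sum>n<M. real n powr - 1) \<le> K + 1)"
    using summableI_nonneg_bounded[of "\<lambda>n::nat. real n powr - 1" "K + 1"] by auto
  then obtain M where M: "(\<Sum>n<M. real n powr - 1) > K + 1" by (auto simp: not_le)
  have "((\<lambda>s. \<Sum>n<M. real n powr - s) \<longlongrightarrow> (\<Sum>n<M. real n powr - 1)) (at_right 1)"
  proof (rule tendsto_sum)
    fix n show "((\<lambda>s. real n powr - s) \<longlongrightarrow> real n powr - 1) (at_right 1)"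
      by (cases "n = 0") (simp, intro tendsto_intros, auto)
  qed
  then have "eventually (\<lambda>s. (\<Sum>n<M. real n powr - s) > K) (at_right 1)"
    using M by (intro order_tendstoD) auto
  moreover have "eventually (\<lambda>s::real. s > 1) (at_right 1)" by (rule eventually_at_right_less)
  ultimately show "eventually (\<lambda>s. K \<le> (\<Sum>\<^sub>\<infinity>n\<in>{1::nat..}. real n powr - s)) (at_right 1)"
  proof eventually_elim
    case (elim s)
    have "(\<Sum>n<M. real n powr - s) = (\<Sum>n\<in>{..<M} \<inter> {1..}. real n powr - s)"
      by (rule sum.mono_neutral_right) (auto simp: not_le)
    also have "\<dots> \<le> (\<Sum>\<^sub>\<infinity>n\<in>{1::nat..}. real n powr - s)"
      by (rule finite_sum_le_infsum[OF summable_on_powr[OF elim(2)]]) auto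
    finally show ?case using elim by simp
  qed
qed

text \<open>Needs only the divergence of zeta. As \<open>ln n \<ge> K + 1\<close> for
  \<open>n \<ge> M\<close>, the series of \<open>ln n * n powr - s\<close>, which is
  \<open>W * Z\<close>, is at least \<open>(K + 1) * Z - (K + 1) * M\<close>. Once \<open>Z\<close>
  exceeds \<open>(K + 1) * M\<close> this is at least \<open>K * Z\<close>, so
  \<open>W \<ge> K\<close>.\<close>

lemma mangoldt_series_at_top:
  "filterlim (\<lambda>s. \<Sum>\<^sub>\<infinity>n\<in>{1::nat..}. mangoldt n * real n powr - s) at_top (at_right 1)"
  unfolding filterlim_at_top
proof
  fix K' :: real
  define K where "K = max K' 0"
  obtain M :: nat where M: "real M > exp (K + 1)" using reals_Archimedean2 by blast
  have "M > 0" using M exp_gt_zero[of "K + 1"] by (cases M) auto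
  have "eventually (\<lambda>s. (K + 1) * real M + 1 \<le> (\<Sum>\<^sub>\<infinity>n\<in>{1::nat..}. real n powr - s)) (at_right 1)"
    using zeta_at_top unfolding filterlim_at_top by blast
  moreover have "eventually (\<lambda>s::real. s > 1) (at_right 1)" by (rule eventually_at_right_less)
  ultimately show "eventually (\<lambda>s. K' \<le> (\<Sum>\<^sub>\<infinity>n\<in>{1::nat..}. mangoldt n * real n powr - s)) (at_right 1)"
  proof eventually_elim
    case (elim s)
    define Z where "Z = (\<Sum>\<^sub>\<infinity>n\<in>{1::nat..}. real n powr - s)"
    define W where "W = (\<Sum>\<^sub>\<infinity>n\<in>{1::nat..}. mangoldt n * real n powr - s)"
    have D: "(\<Sum>\<^sub>\<infinity>n\<in>{1::nat..}. ln (real n) * real n powr - s) = W * Z"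
      using mangoldt_convolution[of "\<lambda>_. 1" s] elim by (simp add: W_def Z_def)
    have h1: "((\<lambda>n. (K + 1) * real n powr - s) has_sum ((K + 1) * Z)) {1..}"
      unfolding Z_def using elim by (intro has_sum_cmult_right has_sum_infsum summable_on_powr)
    have h2: "((\<lambda>n. if n \<in> {1..<M} then (K + 1) * real n powr - s else 0)
        has_sum (\<Sum>n\<in>{1..<M}. (K + 1) * real n powr - s)) {1..}"
      by (rule has_sum_cong_neutral[THEN iffD1, OF _ _ _ has_sum_finite[of "{1..<M}"]]) auto
    have h3: "((\<lambda>n. ln (real n) * real n powr - s) has_sum (W * Z)) {1..}"
      unfolding D[symmetric] using elim by (intro has_sum_infsum summable_on_ln_powr)
    have "(K + 1) * Z \<le> W * Z + (\<Sum>n\<in>{1..<M}. (K + 1) * real n powr - s)"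
    proof (rule has_sum_mono[OF h1 has_sum_add[OF h3 h2]])
      fix n :: nat assume n: "n \<in> {1..}"
      show "(K + 1) * real n powr - s
          \<le> ln (real n) * real n powr - s + (if n \<in> {1..<M} then (K + 1) * real n powr - s else 0)"
      proof (cases "n < M")
        case False
        then have "exp (K + 1) \<le> real n" using M by linarith
        then have "K + 1 \<le> ln (real n)" using n by (subst ln_ge_iff) auto
        then show ?thesis using False by (simp add: mult_right_mono)
      qed (use n in simp)
    qed
    moreover have "(\<Sum>n\<in>{1..<M}. (K + 1) * real n powr - s) \<le> (\<Sum>n\<in>{1..<M}. (K + 1) * 1)"
    proof (intro sum_mono mult_left_mono)
      fix n assume "n \<in> {1..<M}"
      then show "real n powr - s \<le> 1" using powr_mono[of "-s" 0 "real n"] elim by simp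
    qed (simp add: K_def)
    moreover have "(\<Sum>n\<in>{1..<M}. (K + 1) * 1) \<le> (K + 1) * real M"
      using mult_left_mono[of "real (M - 1)" "real M" "K + 1"] by (simp add: K_def mult.commute)
    moreover have Z: "(K + 1) * real M + 1 \<le> Z" using elim by (simp add: Z_def)
    moreover have "(K + 1) * Z = K * Z + Z" by (simp add: algebra_simps)
    ultimately have "K * Z \<le> W * Z" by linarith
    moreover have "Z > 0"
    proof -
      have "(K + 1) * real M \<ge> 0" by (simp add: K_def)
      then show ?thesis using Z by linarith
    qed
    ultimately have "K \<le> W" by simp
    then show ?case by (simp add: K_def W_def)
  qed
qed

text \<open>Off the primes only \<open>p ^ k\<close> with \<open>k \<ge> 2\<close> contribute. For
  fixed \<open>p\<close> they sum to \<open>ln p / (p * (p - 1))\<close>, at most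
  \<open>2 * ln p / p^2\<close>. The divergence of the whole series therefore comes from the
  primes.\<close>

lemma summable_on_mangoldt_nonprime:
  "(\<lambda>n. mangoldt n / real n) summable_on {n. n \<ge> 1 \<and> \<not> prime n}"
proof -
  let ?A = "SIGMA p:{p::nat. prime p}. {2::nat..}"
  let ?f = "\<lambda>(p::nat, k::nat). ln (real p) / real p ^ k"
  have geo: "((\<lambda>k::nat. ln (real p) / real p ^ k) has_sum (ln (real p) / (real p * (real p - 1)))) {2..}"
    if "prime p" for p
  proof -
    have p: "real p > 1" using prime_gt_1_nat[OF that] by simp
    have "(\<lambda>k. (ln (real p) / real p ^ 2) * (1 / real p) ^ k) sums ((ln (real p) / real p ^ 2) * (1 / (1 - 1 / real p)))"
      using p by (intro sums_mult geometric_sums) auto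
    also have "(\<lambda>k. (ln (real p) / real p ^ 2) * (1 / real p) ^ k) = (\<lambda>k. ln (real p) / real p ^ (k + 2))"
      by (simp add: power_add power_one_over field_simps power2_eq_square)
    also have "(ln (real p) / real p ^ 2) * (1 / (1 - 1 / real p)) = ln (real p) / (real p * (real p - 1))"
      using p by (simp add: field_simps power2_eq_square)
    finally have "((\<lambda>k. ln (real p) / real p ^ (k + 2)) has_sum (ln (real p) / (real p * (real p - 1)))) UNIV"
      by (rule sums_nonneg_imp_has_sum) (use p in auto)
    moreover have "bij_betw (\<lambda>k. k + 2) UNIV {2::nat..}"
      by (rule bij_betwI[where g = "\<lambda>n. n - 2"]) auto
    ultimately show ?thesis
      using has_sum_reindex_bij_betw[of "\<lambda>k. k + 2" UNIV "{2..}" "\<lambda>k. ln (real p) / real p ^ k"] by simp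
  qed
  have "?f summable_on ?A"
  proof (rule summable_on_SigmaI)
    show "((\<lambda>k. case (p, k) of (p, k) \<Rightarrow> ln (real p) / real p ^ k) has_sum (ln (real p) / (real p * (real p - 1)))) {2..}"
      if "p \<in> {p. prime p}" for p using geo that by simp
    have "(\<lambda>p::nat. 2 * (ln (real p) * real p powr - 2)) summable_on {p. prime p}"
      by (rule summable_on_subset_banach[OF summable_on_cmult_right[OF summable_on_ln_powr]])
         (auto dest: prime_ge_1_nat)
    then show "(\<lambda>p. ln (real p) / (real p * (real p - 1))) summable_on {p. prime p}"
    proof (rule summable_on_comparison_test)
      fix p :: nat assume "p \<in> {p. prime p}"
      then have p: "real p \<ge> 2" using prime_ge_2_nat[of p] by simp
      have "ln (real p) / (real p * (real p - 1)) \<le> ln (real p) / (real p * (real p / 2))"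
        using p by (intro divide_left_mono mult_left_mono mult_pos_pos) auto
      also have "\<dots> = 2 * (ln (real p) * real p powr - 2)"
        using p by (simp add: powr_minus field_simps power2_eq_square)
      finally show "ln (real p) / (real p * (real p - 1)) \<le> 2 * (ln (real p) * real p powr - 2)" .
      show "0 \<le> ln (real p) / (real p * (real p - 1))" using p by simp
    qed
    show "0 \<le> (case (p, k) of (p, k) \<Rightarrow> ln (real p) / real p ^ k)" if "p \<in> {p. prime p}" for p k
      using that prime_ge_1_nat[of p] by simp
  qed
  moreover have inj: "inj_on (\<lambda>(p, k). p ^ k) ?A"
  proof (rule inj_onI)
    fix x y assume *: "x \<in> ?A" "y \<in> ?A" "(case x of (p, k) \<Rightarrow> p ^ k) = (case y of (p, k) \<Rightarrow> p ^ k)"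
    obtain p k q j where "x = (p, k)" "y = (q, j)" by (cases x, cases y)
    then show "x = y" using * prime_power_inj'[of p q k j] by simp
  qed
  moreover have eq: "mangoldt (p ^ k) / real (p ^ k) = ln (real p) / real p ^ k" if "prime p" "k \<ge> 2" for p k
    using that by simp
  ultimately have "((\<lambda>n. mangoldt n / real n) \<circ> (\<lambda>(p, k). p ^ k)) summable_on ?A"
    using summable_on_cong[of ?A ?f "(\<lambda>n. mangoldt n / real n) \<circ> (\<lambda>(p, k). p ^ k)"] by auto
  then have "(\<lambda>n. mangoldt n / real n) summable_on (\<lambda>(p, k). p ^ k) ` ?A"
    by (subst summable_on_reindex[OF inj])
  then show ?thesis
  proof (rule summable_on_cong_neutral[THEN iffD1, rotated -1])
    fix n :: nat assume "n \<in> {n. n \<ge> 1 \<and> \<not> prime n} - (\<lambda>(p, k). p ^ k) ` ?A"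
    then have n: "\<not> prime n" "n \<notin> (\<lambda>(p, k). p ^ k) ` ?A" by auto
    have "\<not> primepow n"
    proof
      assume "primepow n"
      then obtain p k where pk: "prime p" "k > 0" "n = p ^ k" by (auto simp: primepow_def)
      then have "k \<noteq> 1" using n by auto
      then have "(p, k) \<in> ?A" using pk by auto
      then show False using n(2) pk(3) by force
    qed
    then show "mangoldt n / real n = 0" by (simp add: mangoldt_def)
  next
    fix n :: nat assume "n \<in> (\<lambda>(p, k). p ^ k) ` ?A - {n. n \<ge> 1 \<and> \<not> prime n}"
    then show "mangoldt n / real n = 0"
      by (auto simp: Suc_le_eq prime_power_iff prime_gt_0_nat)
  qed auto
qed

lemma has_sum_finite_sum:
  fixes f :: "'i \<Rightarrow> 'a \<Rightarrow> real"
  assumes "finite S" "\<And>i. i \<in> S \<Longrightarrow> (f i has_sum c i) A"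
  shows "((\<lambda>x. \<Sum>i\<in>S. f i x) has_sum (\<Sum>i\<in>S. c i)) A"
  using assms
proof (induction S rule: finite_induct)
  case (insert i S)
  then show ?case by (simp add: has_sum_add)
qed simp

text \<open>Weigh \<open>mangoldt\<close> by the nonnegative product \<open>W n\<close> of the
  factors \<open>1 + \<epsilon> i * X i n\<close>, which vanishes at a prime prime to the moduli
  with a wrong sign. If no prime had all the prescribed signs, the weighted series would stay
  bounded near \<open>1\<close>. Expanded over subsets of \<open>I\<close>, it is the divergent
  series for the empty set plus bounded ones: for nonempty \<open>S\<close> the product over
  \<open>S\<close> is a non-principal real character.\<close>

theorem prime_with_prescribed_real_characters:
  fixes X :: "'i \<Rightarrow> nat \<Rightarrow> real"
  assumes fin: "finite I"
    and ch: "\<And>i. i \<in> I \<Longrightarrow> real_character (X i) (m i)"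
    and cop: "\<And>i j. i \<in> I \<Longrightarrow> j \<in> I \<Longrightarrow> i \<noteq> j \<Longrightarrow> coprime (m i) (m j)"
    and \<epsilon>: "\<And>i. i \<in> I \<Longrightarrow> \<epsilon> i = 1 \<or> \<epsilon> i = (-1 :: real)"
  shows "\<exists>q. prime q \<and> (\<forall>i\<in>I. X i q = \<epsilon> i)"
proof (rule ccontr)
  assume none: "\<not> ?thesis"
  define W where "W n = (\<Prod>i\<in>I. 1 + \<epsilon> i * X i n)" for n
  have vals: "X i n = -1 \<or> X i n = 0 \<or> X i n = 1" if "i \<in> I" for i n
    using real_character.vals[OF ch[OF that], of n] by auto
  have factor: "0 \<le> 1 + \<epsilon> i * X i n" "1 + \<epsilon> i * X i n \<le> 2" if "i \<in> I" for i n
    using vals[OF that, of n] \<epsilon>[OF that] by auto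
  have W0: "0 \<le> W n" for n unfolding W_def by (intro prod_nonneg) (use factor in auto)
  have W2: "W n \<le> 2 ^ card I" for n
  proof -
    have "W n \<le> (\<Prod>i\<in>I. 2)" unfolding W_def by (intro prod_mono) (use factor in auto)
    then show ?thesis by simp
  qed
  define t where "t s n = mangoldt n * real n powr - s" for s n
  have t0: "t s n \<ge> 0" for s n by (simp add: t_def mangoldt_nonneg)
  have tsum: "t s summable_on {1..}" if "s > 1" for s
    unfolding t_def using that by (rule summable_on_mangoldt_powr)
  define XS where "XS S n = (\<Prod>i\<in>S. X i n)" for S n
  have XS_le: "\<bar>XS S n\<bar> \<le> 1" if "S \<subseteq> I" for S n
  proof -
    have "\<bar>X i n\<bar> \<le> 1" if "i \<in> I" for i using vals[OF that, of n] by auto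
    then show ?thesis unfolding XS_def abs_prod using that by (intro prod_le_1) auto
  qed
  define E where "E S s = (\<Sum>\<^sub>\<infinity>n\<in>{1..}. XS S n * t s n)" for S s
  define eS where "eS S = (\<Prod>i\<in>S. \<epsilon> i)" for S
  have eS: "\<bar>eS S\<bar> = 1" if "S \<subseteq> I" for S
  proof -
    have "\<bar>\<epsilon> i\<bar> = 1" if "i \<in> I" for i using \<epsilon>[OF that] by auto
    then show ?thesis unfolding eS_def abs_prod using that by (intro prod.neutral) auto
  qed
  have W_expand: "W n = (\<Sum>S\<in>Pow I. eS S * XS S n)" for n
  proof -
    have "W n = (\<Prod>i\<in>I. \<epsilon> i * X i n + 1)" by (simp add: W_def add.commute)
    then show ?thesis by (simp add: prod_add[OF fin] eS_def XS_def prod.distrib)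
  qed
  have W_sum: "((\<lambda>n. W n * t s n) has_sum (\<Sum>S\<in>Pow I. eS S * E S s)) {1..}" if "s > 1" for s
  proof -
    have "((\<lambda>n. \<Sum>S\<in>Pow I. eS S * (XS S n * t s n)) has_sum (\<Sum>S\<in>Pow I. eS S * E S s)) {1..}"
      unfolding E_def
    proof (intro has_sum_finite_sum has_sum_cmult_right has_sum_infsum)
      show "(\<lambda>n. XS S n * t s n) summable_on {1..}" if "S \<in> Pow I" for S
        by (rule summable_on_bounded_mult[OF tsum[OF \<open>s > 1\<close>], where C = 1]) (use XS_le that t0 in auto)
    qed (use fin in auto)
    then show ?thesis by (simp add: W_expand sum_distrib_right mult.assoc)
  qed
  obtain D where D: "\<And>s. s > 1 \<Longrightarrow> (\<Sum>S\<in>Pow I. eS S * E S s) \<le> D"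
  proof
    \<comment> \<open>Outside \<open>A\<close> the weighted term is \<open>0\<close>: at a prime
      dividing no modulus every \<open>X i\<close> is \<open>1\<close> or \<open>-1\<close>, so a
      wrong sign makes a factor vanish.\<close>
    define A where "A = {n::nat. n \<ge> 1 \<and> \<not> prime n} \<union> {q. q dvd (\<Prod>i\<in>I. m i)}"
    have mpos: "(\<Prod>i\<in>I. m i) > 0"
      using ch real_character.N_pos by (intro prod_pos) blast
    have finT: "finite {q. q dvd (\<Prod>i\<in>I. m i)}" using mpos by simp
    have A1: "n \<ge> 1" if "n \<in> A" for n using that mpos unfolding A_def by (auto simp: Suc_le_eq intro!: Nat.gr0I)
    have smA: "(\<lambda>n. mangoldt n / real n) summable_on A"
      unfolding A_def by (intro summable_on_union summable_on_mangoldt_nonprime summable_on_finite finT)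
    fix s :: real assume s: "s > 1"
    have "((\<lambda>n. W n * t s n) has_sum (\<Sum>S\<in>Pow I. eS S * E S s)) A"
    proof (rule has_sum_cong_neutral[THEN iffD1, OF _ _ _ W_sum[OF s]])
      fix n assume "n \<in> {1..} - A"
      then have n: "prime n" "\<not> n dvd (\<Prod>i\<in>I. m i)" by (auto simp: A_def)
      obtain i where i: "i \<in> I" "X i n \<noteq> \<epsilon> i" using none n by blast
      have "\<not> n dvd m i" using n i fin by (meson dvd_prod_eqI dvd_trans dvd_prodI)
      then have "coprime n (m i)" using n by (simp add: prime_imp_coprime)
      then have "X i n \<noteq> 0" by (rule real_character.nonzero[OF ch[OF i(1)]])
      then have "1 + \<epsilon> i * X i n = 0" using vals[OF i(1), of n] \<epsilon>[OF i(1)] i(2) by auto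
      then show "W n * t s n = 0" unfolding W_def using fin i(1) by (auto intro!: prod_zero)
    qed (use A1 in auto)
    moreover have "((\<lambda>n. 2 ^ card I * (mangoldt n / real n)) has_sum (2 ^ card I * (\<Sum>\<^sub>\<infinity>n\<in>A. mangoldt n / real n))) A"
      by (intro has_sum_cmult_right has_sum_infsum smA)
    ultimately show "(\<Sum>S\<in>Pow I. eS S * E S s) \<le> 2 ^ card I * (\<Sum>\<^sub>\<infinity>n\<in>A. mangoldt n / real n)"
    proof (rule has_sum_mono)
      fix n assume "n \<in> A"
      then have "n \<ge> 1" by (rule A1)
      then have "real n powr - s \<le> real n powr - 1" using s by (intro powr_mono) auto
      then have "t s n \<le> mangoldt n / real n"
        unfolding t_def using \<open>n \<ge> 1\<close> mult_left_mono[OF _ mangoldt_nonneg[of n], of "real n powr - s" "real n powr - 1"]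
        by (simp add: powr_minus divide_inverse)
      then show "W n * t s n \<le> 2 ^ card I * (mangoldt n / real n)"
        using W0 W2 t0 by (intro mult_mono) auto
    qed
  qed
  have "\<exists>C. eventually (\<lambda>s. \<bar>E S s\<bar> \<le> C) (at_right 1)" if "S \<in> Pow I - {{}}" for S
  proof -
    have "real_character (XS S) (\<Prod>i\<in>S. m i)"
      unfolding XS_def using that fin by (intro real_character_prod ch cop) (auto intro: finite_subset)
    from real_character.mangoldt_series_bounded[OF this] show ?thesis by (simp add: E_def t_def)
  qed
  then obtain C where C: "\<And>S. S \<in> Pow I - {{}} \<Longrightarrow> eventually (\<lambda>s. \<bar>E S s\<bar> \<le> C S) (at_right 1)"
    by metis
  have "eventually (\<lambda>s. \<forall>S\<in>Pow I - {{}}. \<bar>E S s\<bar> \<le> C S) (at_right 1)"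
    using fin C by (intro eventually_ball_finite) auto
  \<comment> \<open>The term of the empty set outgrows the bounds of all other terms together with
    the bound \<open>D\<close> of the total.\<close>
  moreover have "eventually (\<lambda>s. D + (\<Sum>S\<in>Pow I - {{}}. C S) + 1 \<le> E {} s) (at_right 1)"
    using mangoldt_series_at_top unfolding filterlim_at_top E_def XS_def t_def by simp
  moreover have "eventually (\<lambda>s::real. s > 1) (at_right 1)" by (rule eventually_at_right_less)
  ultimately have "eventually (\<lambda>s::real. False) (at_right 1)"
  proof eventually_elim
    case (elim s)
    have "(\<Sum>S\<in>Pow I. eS S * E S s) = eS {} * E {} s + (\<Sum>S\<in>Pow I - {{}}. eS S * E S s)"
      using fin by (intro sum.remove) auto
    moreover have "eS {} = 1" by (simp add: eS_def)
    moreover have "- (\<Sum>S\<in>Pow I - {{}}. C S) \<le> (\<Sum>S\<in>Pow I - {{}}. eS S * E S s)"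
      unfolding sum_negf[symmetric]
    proof (rule sum_mono)
      fix S assume S: "S \<in> Pow I - {{}}"
      then have "\<bar>eS S * E S s\<bar> \<le> C S" using elim(1) eS[of S] by (simp add: abs_mult)
      then show "- C S \<le> eS S * E S s" by linarith
    qed
    ultimately show ?case using D[of s] elim by simp
  qed
  then show False by simp
qed

section \<open>Quadratic residues\<close>

lemma Legendre_vals: "Legendre a p \<in> {-1, 0, 1}"
  by (simp add: Legendre_def)

lemma Legendre_eq_0_iff: "Legendre a p = 0 \<longleftrightarrow> p dvd a"
  by (simp add: Legendre_def cong_0_iff)

lemma Legendre_cong:
  assumes "[a = b] (mod p)"
  shows "Legendre a p = Legendre b p"
proof -
  have "[a = 0] (mod p) \<longleftrightarrow> [b = 0] (mod p)" "QuadRes p a \<longleftrightarrow> QuadRes p b"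
    using assms unfolding QuadRes_def by (meson cong_sym cong_trans)+
  then show ?thesis by (simp add: Legendre_def)
qed

text \<open>Turns the congruences of Euler's criterion into equations between Legendre
  symbols.\<close>

lemma eq_if_cong_small:
  fixes a b p :: int
  assumes "[a = b] (mod p)" "p > 2" "a \<in> {-1, 0, 1}" "b \<in> {-1, 0, 1}"
  shows "a = b"
proof -
  have "p dvd a - b" using assms(1) by (simp add: cong_iff_dvd_diff)
  moreover have "\<bar>a - b\<bar> < p" using assms by auto
  ultimately show ?thesis using dvd_imp_le_int[of "a - b" p] by fastforce
qed

lemma Legendre_mult:
  assumes "prime p" "p > (2::nat)"
  shows "Legendre (a * b) p = Legendre a p * Legendre b p"
proof (rule eq_if_cong_small)
  have "[Legendre (a * b) p = (a * b) ^ ((p - 1) div 2)] (mod p)"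
    "[Legendre a p * Legendre b p = a ^ ((p - 1) div 2) * b ^ ((p - 1) div 2)] (mod p)"
    using euler_criterion[OF assms] cong_mult by blast+
  then show "[Legendre (a * b) p = Legendre a p * Legendre b p] (mod p)"
    by (metis cong_sym cong_trans power_mult_distrib)
qed (use assms Legendre_vals[of "a * b" p] Legendre_vals[of a p] Legendre_vals[of b p] in auto)

lemma Legendre_1:
  assumes "p > (1::nat)"
  shows "Legendre 1 p = 1"
proof -
  have "\<not> int p dvd 1" using assms by auto
  moreover have "QuadRes p 1" unfolding QuadRes_def by (intro exI[of _ 1]) simp
  ultimately show ?thesis by (simp add: Legendre_def cong_0_iff)
qed

lemma Legendre_prod:
  assumes "prime p" "p > (2::nat)" "finite S"
  shows "Legendre (\<Prod>x\<in>S. f x) p = (\<Prod>x\<in>S. Legendre (f x) p)"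
  using assms(3)
  by (induction S rule: finite_induct) (use assms in \<open>simp_all add: Legendre_mult Legendre_1\<close>)

lemma Legendre_minus_1:
  assumes "prime p" "p > (2::nat)"
  shows "Legendre (-1) p = (if p mod 4 = 1 then 1 else -1)"
proof -
  have "odd p" using assms prime_odd_nat by auto
  have "(-1::int) ^ ((p - 1) div 2) = (if p mod 4 = 1 then 1 else -1)"
  proof (cases "p mod 4 = 1")
    case True
    then have "even ((p - 1) div 2)" by presburger
    then show ?thesis using True by simp
  next
    case False
    then have "odd ((p - 1) div 2)" using \<open>odd p\<close> by presburger
    then show ?thesis using False by simp
  qed
  moreover have "Legendre (-1) p = (-1) ^ ((p - 1) div 2)"
    by (rule eq_if_cong_small[OF euler_criterion[OF assms]])
       (use assms Legendre_vals in \<open>auto simp: minus_one_power_iff\<close>)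
  ultimately show ?thesis by simp
qed

text \<open>Gauss's lemma: among \<open>2, 4, ..., 2 * h\<close> with \<open>p = 2 * h + 1\<close>,
  exactly \<open>h - h div 2\<close> exceed \<open>h\<close>, and the parity of this count depends
  on \<open>p\<close> modulo \<open>8\<close>.\<close>

lemma Legendre_2:
  assumes "prime p" "p > (2::nat)"
  shows "Legendre 2 p = (if p mod 8 = 1 \<or> p mod 8 = 7 then 1 else -1)"
proof -
  have "odd p" using assms prime_odd_nat by auto
  interpret GAUSS p 2
    by unfold_locales (use assms in \<open>auto simp: cong_0_iff zdvd_not_zless\<close>)
  define h where "h = (p - 1) div 2"
  have h: "(int p - 1) div 2 = int h" "p = 2 * h + 1"
    using \<open>odd p\<close> unfolding h_def by (auto elim!: oddE)
  \<comment> \<open>The doubled numbers are below \<open>p\<close>, so reduction modulo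
    \<open>p\<close> leaves them unchanged.\<close>
  have C: "C = (\<lambda>x. 2 * x) ` {0<..int h}"
    unfolding C_def B_def A_def image_image h(1) by (intro image_cong) (auto simp: h(2))
  have "E = (\<lambda>x. 2 * x) ` {int h div 2<..int h}"
  proof (intro equalityI subsetI)
    fix y assume "y \<in> E"
    then obtain x where x: "y = 2 * x" "x \<le> int h" "int h < y" unfolding E_def C h(1) by auto
    then have "int h div 2 < x" by linarith
    then show "y \<in> (\<lambda>x. 2 * x) ` {int h div 2<..int h}" using x by auto
  next
    fix y assume "y \<in> (\<lambda>x. 2 * x) ` {int h div 2<..int h}"
    then obtain x where x: "y = 2 * x" "int h div 2 < x" "x \<le> int h" by auto
    then have "0 < x" "int h < y" by linarith+
    then show "y \<in> E" using x unfolding E_def C h(1) by auto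
  qed
  then have "card E = nat (int h - int h div 2)"
    by (simp add: card_image inj_on_def)
  then have "card E = h - h div 2" by linarith
  then have L: "Legendre 2 p = (-1) ^ (h - h div 2)" using gauss_lemma by simp
  have par: "even (h - h div 2) \<longleftrightarrow> p mod 8 = 1 \<or> p mod 8 = 7"
  proof -
    have "even (h - h div 2) \<longleftrightarrow> h mod 4 = 0 \<or> h mod 4 = 3" by presburger
    moreover have "h mod 4 = 0 \<longleftrightarrow> p mod 8 = 1" "h mod 4 = 3 \<longleftrightarrow> p mod 8 = 7" unfolding h(2) by presburger+
    ultimately show ?thesis by simp
  qed
  show ?thesis unfolding L minus_one_power_iff par by simp
qed

lemma Legendre_minus_2:
  assumes "prime p" "p > (2::nat)"
  shows "Legendre (-2) p = (if p mod 8 = 1 \<or> p mod 8 = 3 then 1 else -1)"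
proof -
  have "odd p" using assms prime_odd_nat by auto
  then have "p mod 8 = 1 \<or> p mod 8 = 3 \<or> p mod 8 = 5 \<or> p mod 8 = 7" by presburger
  moreover have "p mod 4 = p mod 8 mod 4" by (simp add: mod_mod_cancel)
  ultimately show ?thesis
    using Legendre_mult[OF assms, of "-1" 2] Legendre_minus_1[OF assms] Legendre_2[OF assms] by auto
qed

text \<open>Without a non-residue, squaring would be onto, hence injective, on the nonzero residues;
  but \<open>1\<close> and \<open>p - 1\<close> have the same square.\<close>

lemma exists_quadratic_nonresidue:
  assumes "prime p" "p > (2::nat)"
  shows "\<exists>a::nat. Legendre (int a) (int p) = -1"
proof (rule ccontr)
  assume none: "\<not> ?thesis"
  let ?f = "\<lambda>x::int. x\<^sup>2 mod p"
  have "{1..<int p} \<subseteq> ?f ` {1..<int p}"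
  proof
    fix a assume a: "a \<in> {1..<int p}"
    then have "\<not> int p dvd a" by (simp add: zdvd_not_zless)
    then have "Legendre a p = 1"
      using none[simplified, rule_format, of "nat a"] a Legendre_vals[of a p] Legendre_eq_0_iff[of a p] by auto
    then obtain y where y: "[y\<^sup>2 = a] (mod p)"
      unfolding Legendre_def QuadRes_def by (auto split: if_splits)
    have "\<not> int p dvd y\<^sup>2" using y \<open>\<not> int p dvd a\<close> cong_dvd_iff by blast
    then have "\<not> int p dvd y" by (auto simp: power2_eq_square)
    then have "y mod p \<in> {1..<int p}" using assms
      by (simp add: dvd_eq_mod_eq_0) (metis mod_int_pos_iff of_nat_0_less_iff order_le_less int_one_le_iff_zero_less prime_gt_0_nat)
    moreover have "?f (y mod p) = a" using y a by (simp add: cong_def power_mod)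
    ultimately show "a \<in> ?f ` {1..<int p}" by blast
  qed
  then have "card {1..<int p} \<le> card (?f ` {1..<int p})" by (intro card_mono) auto
  then have "inj_on ?f {1..<int p}"
    by (intro eq_card_imp_inj_on antisym card_image_le) auto
  moreover have "?f 1 = ?f (int p - 1)"
  proof -
    have "(int p - 1)\<^sup>2 = 1 + int p * (int p - 2)" by (simp add: power2_eq_square algebra_simps)
    then show ?thesis by simp
  qed
  ultimately have "1 = int p - 1" by (rule inj_onD) (use assms in auto)
  then show False using assms by simp
qed

text \<open>This and \<open>chi_minus8\<close> are the Kronecker symbols of discriminant
  \<open>-4\<close> and \<open>-8\<close>; at an odd prime they are the Legendre symbols of
  \<open>-1\<close> and \<open>-2\<close>, and they extend these multiplicatively to composite
  numbers.\<close>

definition chi_minus4 :: "nat \<Rightarrow> int" where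
  "chi_minus4 n = (if n mod 4 = 1 then 1 else if n mod 4 = 3 then -1 else 0)"

definition chi_minus8 :: "nat \<Rightarrow> int" where
  "chi_minus8 n = (if n mod 8 \<in> {1, 3} then 1 else if n mod 8 \<in> {5, 7} then -1 else 0)"

lemma chi_minus4_mult: "chi_minus4 (m * n) = chi_minus4 m * chi_minus4 n"
proof -
  have "m mod 4 = 0 \<or> m mod 4 = 1 \<or> m mod 4 = 2 \<or> m mod 4 = 3"
    "n mod 4 = 0 \<or> n mod 4 = 1 \<or> n mod 4 = 2 \<or> n mod 4 = 3" by presburger+
  then show ?thesis unfolding chi_minus4_def mod_mult_eq[of m 4 n, symmetric] by (elim disjE) simp_all
qed

lemma chi_minus8_mult: "chi_minus8 (m * n) = chi_minus8 m * chi_minus8 n"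
proof -
  have "m mod 8 = 0 \<or> m mod 8 = 1 \<or> m mod 8 = 2 \<or> m mod 8 = 3 \<or> m mod 8 = 4 \<or> m mod 8 = 5 \<or> m mod 8 = 6 \<or> m mod 8 = 7"
    "n mod 8 = 0 \<or> n mod 8 = 1 \<or> n mod 8 = 2 \<or> n mod 8 = 3 \<or> n mod 8 = 4 \<or> n mod 8 = 5 \<or> n mod 8 = 6 \<or> n mod 8 = 7" by presburger+
  then show ?thesis unfolding chi_minus8_def mod_mult_eq[of m 8 n, symmetric] by (elim disjE) simp_all
qed

lemma chi_minus4_prod: "chi_minus4 (\<Prod>x\<in>S. f x) = (\<Prod>x\<in>S. chi_minus4 (f x))"
  by (induction S rule: infinite_finite_induct) (simp_all add: chi_minus4_mult, simp_all add: chi_minus4_def)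

lemma chi_minus8_prod: "chi_minus8 (\<Prod>x\<in>S. f x) = (\<Prod>x\<in>S. chi_minus8 (f x))"
  by (induction S rule: infinite_finite_induct) (simp_all add: chi_minus8_mult, simp_all add: chi_minus8_def)

lemma real_character_chi_minus4: "real_character (\<lambda>n. real_of_int (chi_minus4 n)) 4"
proof
  show "\<exists>a. coprime a 4 \<and> real_of_int (chi_minus4 a) = -1"
    using coprime_add_one_right[of "3::nat"] by (intro exI[of _ 3]) (simp add: chi_minus4_def)
  show "real_of_int (chi_minus4 n) \<in> {-1, 0, 1}" for n by (simp add: chi_minus4_def)
qed (simp_all add: chi_minus4_mult, simp_all add: chi_minus4_def)

lemma real_character_Legendre:
  assumes "prime p" "p > (2::nat)"
  shows "real_character (\<lambda>n. real_of_int (Legendre (int n) (int p))) p"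
proof
  obtain a :: nat where a: "Legendre (int a) (int p) = -1"
    using exists_quadratic_nonresidue[OF assms] by blast
  then have "\<not> int p dvd int a" using Legendre_eq_0_iff[of "int a" "int p"] by auto
  then have "coprime a p" using assms by (metis coprime_commute int_dvd_int_iff prime_imp_coprime)
  then show "\<exists>a. coprime a p \<and> real_of_int (Legendre (int a) (int p)) = -1" using a by auto
  show "real_of_int (Legendre (int n) (int p)) \<in> {-1, 0, 1}" for n
    using Legendre_vals[of "int n" "int p"] by auto
  show "real_of_int (Legendre (int (n + p)) (int p)) = real_of_int (Legendre (int n) (int p))" for n
    using Legendre_cong[of "int (n + p)" "int n" "int p"] by (simp add: cong_def)
  show "real_of_int (Legendre (int 1) (int p)) = 1" using Legendre_1[of p] assms by simp
qed (use assms in \<open>simp_all add: Legendre_mult\<close>)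

section \<open>Sums of three squares\<close>

text \<open>Thue's lemma for two congruences: the box has more points than there are pairs of
  residues, and two points with equal residues are subtracted.\<close>

lemma pigeonhole_two_congruences:
  fixes n Q Z S U :: nat and \<alpha> \<beta> :: int
  assumes "n > 0" "Q > 0" and box: "n * Q < (Z + 1) * (S + 1) * (U + 1)"
  obtains z s t :: int where "z \<noteq> 0 \<or> s \<noteq> 0 \<or> t \<noteq> 0" "\<bar>z\<bar> \<le> Z" "\<bar>s\<bar> \<le> S" "\<bar>t\<bar> \<le> U"
    "int n dvd z - \<alpha> * s" "int Q dvd z - \<beta> * t"
proof -
  let ?B = "{0..int Z} \<times> {0..int S} \<times> {0..int U}"
  define f where "f = (\<lambda>(z, s, t). ((z - \<alpha> * s) mod int n, (z - \<beta> * t) mod int Q))"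
  have "f ` ?B \<subseteq> {0..<int n} \<times> {0..<int Q}"
    using assms(1,2) by (auto simp: f_def)
  then have "card (f ` ?B) \<le> n * Q"
    using card_mono[of "{0..<int n} \<times> {0..<int Q}" "f ` ?B"] by (simp add: card_cartesian_product)
  also have "n * Q < card ?B"
  proof -
    have "card {0..int k} = k + 1" for k by simp
    then show ?thesis using box by (simp only: card_cartesian_product mult.assoc)
  qed
  finally have "\<not> inj_on f ?B" by (rule pigeonhole)
  then obtain u v where uv: "u \<in> ?B" "v \<in> ?B" "f u = f v" "u \<noteq> v"
    by (auto simp: inj_on_def)
  obtain z s t z' s' t' where [simp]: "u = (z, s, t)" "v = (z', s', t')"
    by (cases u, cases v)
  have "(z - \<alpha> * s) mod int n = (z' - \<alpha> * s') mod int n" "(z - \<beta> * t) mod int Q = (z' - \<beta> * t') mod int Q"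
    using uv(3) by (simp_all add: f_def)
  then have "int n dvd (z - \<alpha> * s) - (z' - \<alpha> * s')" "int Q dvd (z - \<beta> * t) - (z' - \<beta> * t')"
    by (simp_all add: mod_eq_dvd_iff)
  moreover have "(z - \<alpha> * s) - (z' - \<alpha> * s') = (z - z') - \<alpha> * (s - s')"
    "(z - \<beta> * t) - (z' - \<beta> * t') = (z - z') - \<beta> * (t - t')"
    by (simp_all add: algebra_simps)
  ultimately have dvd: "int n dvd (z - z') - \<alpha> * (s - s')" "int Q dvd (z - z') - \<beta> * (t - t')" by simp_all
  have "z - z' \<noteq> 0 \<or> s - s' \<noteq> 0 \<or> t - t' \<noteq> 0" using uv(4) by auto
  moreover have "\<bar>z - z'\<bar> \<le> Z" "\<bar>s - s'\<bar> \<le> S" "\<bar>t - t'\<bar> \<le> U" using uv(1,2) by auto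
  ultimately show thesis using dvd by (rule that)
qed

lemma less_Suc_floor_sqrt_power2: "n < (floor_sqrt n + 1)\<^sup>2"
  using Suc_floor_sqrt_power2_gt[of n] by simp

lemma abs_le_floor_sqrt_imp:
  assumes "\<bar>z::int\<bar> \<le> int (floor_sqrt n)"
  shows "z\<^sup>2 \<le> int n"
proof -
  have "z\<^sup>2 \<le> (int (floor_sqrt n))\<^sup>2" using assms power_mono[of "\<bar>z\<bar>" _ 2] by simp
  also have "\<dots> \<le> int n" using floor_sqrt_power2_le[of n] by (simp flip: of_nat_power)
  finally show ?thesis .
qed

text \<open>Thue's argument: with \<open>z\<close> congruent to \<open>\<alpha> * s\<close>, the
  number \<open>z^2 + s^2\<close> is a positive multiple of \<open>q\<close>, and it is below
  \<open>2 * q\<close> because \<open>q\<close> is not a square.\<close>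

lemma prime_sum_of_two_squares:
  fixes \<alpha> :: int
  assumes "prime q" "int q dvd \<alpha>\<^sup>2 + 1"
  obtains u v :: int where "int q = u\<^sup>2 + v\<^sup>2"
proof -
  define r where "r = floor_sqrt q"
  have q0: "q > 0" using assms(1) prime_gt_0_nat by auto
  \<comment> \<open>The second congruence is taken modulo \<open>1\<close> and its variable confined
    to \<open>0\<close>, so only one congruence in two variables remains.\<close>
  have "q * 1 < (r + 1) * (r + 1) * (0 + 1)"
    using less_Suc_floor_sqrt_power2[of q] by (simp add: r_def power2_eq_square)
  from pigeonhole_two_congruences[OF q0 zero_less_one this, of \<alpha> 0]
  obtain z s t :: int where zs: "z \<noteq> 0 \<or> s \<noteq> 0 \<or> t \<noteq> 0" "\<bar>z\<bar> \<le> int r" "\<bar>s\<bar> \<le> int r" "\<bar>t\<bar> \<le> int 0"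
    "int q dvd z - \<alpha> * s" "int 1 dvd z - 0 * t" .
  have "z\<^sup>2 + s\<^sup>2 = (z - \<alpha> * s) * (z + \<alpha> * s) + (\<alpha>\<^sup>2 + 1) * s\<^sup>2"
    by (simp add: power2_eq_square algebra_simps)
  moreover have "int q dvd \<dots>" using zs(5) assms(2) by simp
  ultimately have dvd: "int q dvd z\<^sup>2 + s\<^sup>2" by simp
  have nsq: "x\<^sup>2 \<noteq> int q" for x :: int
  proof
    assume "x\<^sup>2 = int q"
    then have "(nat \<bar>x\<bar>)\<^sup>2 = q" by (metis nat_abs_mult_distrib nat_int abs_of_nat power2_eq_square)
    then have "prime ((nat \<bar>x\<bar>)\<^sup>2)" using assms(1) by simp
    then show False by (simp add: prime_power_iff)
  qed
  have le: "z\<^sup>2 < int q" "s\<^sup>2 < int q"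
    using abs_le_floor_sqrt_imp zs(2,3) nsq by (force simp: r_def less_le)+
  have pos: "0 < z\<^sup>2 + s\<^sup>2" using zs(1,4) by (auto simp: sum_power2_gt_zero_iff)
  obtain k where k: "z\<^sup>2 + s\<^sup>2 = int q * k" using dvd by blast
  have "int q * k < int q * 2" using k le by linarith
  then have "k < 2" using q0 by simp
  moreover have "0 < k" using k pos q0 by (simp add: zero_less_mult_iff)
  ultimately have "k = 1" by simp
  then show thesis using k that[of z s] by simp
qed

text \<open>A case of Legendre's theorem on ternary forms. The box sides exceed the square roots of
  \<open>n * Q\<close>, \<open>n\<close> and \<open>Q\<close>, whose product is
  \<open>n * Q\<close>, so the pigeonhole lemma applies. The assumptions \<open>nsq\<close> make the
  bounds on \<open>z^2\<close> and \<open>t^2\<close> strict, which keeps \<open>V\<close> strictly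
  inside its interval.\<close>

lemma legendre_isotropic:
  fixes n Q :: nat and \<alpha> \<beta> :: int
  assumes n: "n > 0" and Q: "Q > 0" and cop: "coprime n Q"
    and \<alpha>: "int n dvd \<alpha>\<^sup>2 + int Q" and \<beta>: "int Q dvd \<beta>\<^sup>2 - int n"
    and nsq: "\<And>x::int. x\<^sup>2 \<noteq> int Q" "\<And>x::int. x\<^sup>2 \<noteq> int (n * Q)"
  obtains T z s :: int where "T > 0" "int n * T\<^sup>2 = z\<^sup>2 + int Q * s\<^sup>2"
proof -
  define Z S U where "Z = floor_sqrt (n * Q)" and "S = floor_sqrt n" and "U = floor_sqrt Q"
  have "n * Q < (Z + 1) * (S + 1) * (U + 1)"
  proof (rule power2_less_imp_less)
    have "n * Q * (n * Q) < (Z + 1)\<^sup>2 * ((S + 1)\<^sup>2 * (U + 1)\<^sup>2)"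
      unfolding Z_def S_def U_def
      by (intro mult_strict_mono less_Suc_floor_sqrt_power2) (use n Q in auto)
    also have "\<dots> = ((Z + 1) * (S + 1) * (U + 1))\<^sup>2"
      by (simp only: power_mult_distrib mult.assoc)
    finally show "(n * Q)\<^sup>2 < ((Z + 1) * (S + 1) * (U + 1))\<^sup>2"
      by (simp only: power2_eq_square[of "n * Q"])
  qed simp
  from pigeonhole_two_congruences[OF n Q this, of \<alpha> \<beta>]
  obtain z s t :: int where zst: "z \<noteq> 0 \<or> s \<noteq> 0 \<or> t \<noteq> 0" "\<bar>z\<bar> \<le> Z" "\<bar>s\<bar> \<le> S" "\<bar>t\<bar> \<le> U"
    "int n dvd z - \<alpha> * s" "int Q dvd z - \<beta> * t" .
  \<comment> \<open>\<open>V\<close> is a multiple of \<open>nQ\<close> lying strictly between \<open>-nQ\<close> and \<open>2nQ\<close>, hence \<open>0\<close> or \<open>nQ\<close>; in the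
    latter case multiply \<open>z\<^sup>2 + Q s\<^sup>2 = n (t\<^sup>2 + Q)\<close> by \<open>t\<^sup>2 + Q\<close> and compose.\<close>
  define V where "V = z\<^sup>2 + int Q * s\<^sup>2 - int n * t\<^sup>2"
  have "V = (z - \<alpha> * s) * (z + \<alpha> * s) + (\<alpha>\<^sup>2 + int Q) * s\<^sup>2 - int n * t\<^sup>2"
    by (simp add: V_def power2_eq_square algebra_simps)
  then have dn: "int n dvd V" using zst(5) \<alpha> by simp
  have "V = (z - \<beta> * t) * (z + \<beta> * t) + (\<beta>\<^sup>2 - int n) * t\<^sup>2 + int Q * s\<^sup>2"
    by (simp add: V_def power2_eq_square algebra_simps)
  then have dQ: "int Q dvd V" using zst(6) \<beta> by simp
  have "int n * int Q dvd V" using dn dQ cop by (intro divides_mult) auto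
  then obtain k where k: "V = int n * int Q * k" by blast
  have pos: "int n * int Q > 0" using n Q by simp
  have b1: "z\<^sup>2 < int n * int Q"
    using abs_le_floor_sqrt_imp[of z "n * Q"] zst(2) nsq(2)[of z] by (simp add: Z_def less_le)
  have b2: "int Q * s\<^sup>2 \<le> int n * int Q"
    using abs_le_floor_sqrt_imp[of s n] zst(3) Q by (simp add: S_def)
  have "t\<^sup>2 < int Q"
    using abs_le_floor_sqrt_imp[of t Q] zst(4) nsq(1)[of t] by (simp add: U_def less_le)
  then have b3: "int n * t\<^sup>2 < int n * int Q" using n by simp
  have nn: "0 \<le> z\<^sup>2" "0 \<le> int Q * s\<^sup>2" "0 \<le> int n * t\<^sup>2" by simp_all
  have "int n * int Q * k < int n * int Q * 2" "int n * int Q * (-1) < int n * int Q * k"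
    using b1 b2 b3 nn k unfolding V_def by linarith+
  then have "k < 2" "-1 < k" using pos mult_less_cancel_left_pos by blast+
  then consider "k = 0" | "k = 1" by linarith
  then show thesis
  proof cases
    case 1
    then have eq: "int n * t\<^sup>2 = z\<^sup>2 + int Q * s\<^sup>2" using k by (simp add: V_def)
    have "t \<noteq> 0"
    proof
      assume "t = 0"
      then have "z\<^sup>2 + int Q * s\<^sup>2 = 0" using eq by simp
      then have "z\<^sup>2 = 0" "int Q * s\<^sup>2 = 0" using nn by linarith+
      then show False using zst(1) Q \<open>t = 0\<close> by auto
    qed
    then show thesis using that[of "\<bar>t\<bar>" z s] eq by simp
  next
    case 2
    then have eq: "z\<^sup>2 + int Q * s\<^sup>2 = int n * (t\<^sup>2 + int Q)" using k by (simp add: V_def algebra_simps)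
    have "int n * (t\<^sup>2 + int Q)\<^sup>2 = (int n * (t\<^sup>2 + int Q)) * (t\<^sup>2 + int Q)"
      by (simp add: power2_eq_square)
    also have "\<dots> = (z * t + int Q * s)\<^sup>2 + int Q * (z - s * t)\<^sup>2"
      unfolding eq[symmetric] by (simp add: power2_eq_square algebra_simps)
    finally show thesis using Q by (intro that[of "t\<^sup>2 + int Q"]) (auto simp: add_nonneg_pos)
  qed
qed

section \<open>Descent from rational to integral points on a sphere\<close>

lemma nearest_integer_multiple:
  fixes x T :: int
  assumes "T > 0"
  obtains a where "2 * \<bar>x - a * T\<bar> \<le> T"
proof (cases "2 * (x mod T) \<le> T")
  case True
  then show thesis using assms by (intro that[of "x div T"]) (simp add: minus_div_mult_eq_mod)
next
  case False
  have eq: "x - (x div T + 1) * T = x mod T - T" by (simp add: algebra_simps minus_mult_div_eq_mod)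
  have "x mod T < T" using assms by simp
  then have "\<bar>x - (x div T + 1) * T\<bar> = T - x mod T" unfolding eq by simp
  then show thesis using False by (intro that[of "x div T + 1"]) simp
qed

lemma davenport_cassels:
  fixes n x y z :: int and T :: nat
  assumes "T > 0" "n * (int T)\<^sup>2 = x\<^sup>2 + y\<^sup>2 + z\<^sup>2"
  shows "\<exists>a b c. n = a\<^sup>2 + b\<^sup>2 + c\<^sup>2"
  using assms
proof (induction T arbitrary: x y z rule: less_induct)
  case (less T)
  have T: "int T > 0" using less by simp
  obtain a where a: "2 * \<bar>x - a * int T\<bar> \<le> int T" using nearest_integer_multiple[OF T] .
  obtain b where b: "2 * \<bar>y - b * int T\<bar> \<le> int T" using nearest_integer_multiple[OF T] .
  obtain c where c: "2 * \<bar>z - c * int T\<bar> \<le> int T" using nearest_integer_multiple[OF T] .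
  \<comment> \<open>The line through \<open>(a, b, c)\<close> and \<open>(x, y, z)/T\<close> meets the sphere of radius \<open>\<surd>n\<close> again in a rational
    point with the smaller denominator \<open>T'\<close>.\<close>
  define A where "A = a\<^sup>2 + b\<^sup>2 + c\<^sup>2"
  define d where "d = a * x + b * y + c * z"
  define j where "j = A - n"
  define M where "M = 2 * (n * int T - d)"
  define T' where "T' = j * int T + M"
  have eq: "int T * T' = (x - a * int T)\<^sup>2 + (y - b * int T)\<^sup>2 + (z - c * int T)\<^sup>2"
  proof -
    have "int T * T' = n * (int T)\<^sup>2 - 2 * int T * d + A * (int T)\<^sup>2"
      by (simp add: T'_def M_def j_def power2_eq_square algebra_simps)
    also have "\<dots> = (x\<^sup>2 + y\<^sup>2 + z\<^sup>2) - 2 * int T * d + A * (int T)\<^sup>2" using less by simp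
    finally show ?thesis by (simp add: A_def d_def power2_eq_square algebra_simps)
  qed
  show ?case
  proof (cases "T' = 0")
    \<comment> \<open>The rational point is then itself the integral point
      \<open>(a, b, c)\<close>.\<close>
    case True
    then have "(x - a * int T)\<^sup>2 + ((y - b * int T)\<^sup>2 + (z - c * int T)\<^sup>2) = 0" using eq by simp
    then have "x = a * int T" "y = b * int T" "z = c * int T"
      by (simp_all add: add_nonneg_eq_0_iff)
    then have "n * (int T)\<^sup>2 = A * (int T)\<^sup>2" using less by (simp add: A_def power_mult_distrib algebra_simps)
    then have "n = A" using T by simp
    then show ?thesis unfolding A_def by blast
  next
    case False
    have sq: "4 * w\<^sup>2 \<le> (int T)\<^sup>2" if "2 * \<bar>w\<bar> \<le> int T" for w
      using power_mono[OF that, of 2] by (simp add: power_mult_distrib)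
    \<comment> \<open>Each coordinate is within \<open>1/2\<close> of an integer, so the squared
      distance is at most \<open>3/4\<close>. For three squares this is below \<open>1\<close>,
      which makes the denominator shrink.\<close>
    have "4 * (int T * T') \<le> 3 * (int T)\<^sup>2"
      unfolding eq using sq[OF a] sq[OF b] sq[OF c] by simp
    then have "int T * (4 * T') \<le> int T * (3 * int T)" by (simp add: power2_eq_square algebra_simps)
    then have "4 * T' \<le> 3 * int T" using T by simp
    moreover have "0 \<le> int T * T'" unfolding eq by simp
    then have "T' > 0" using T False by (simp add: zero_le_mult_iff)
    ultimately have T': "nat T' < T" "nat T' > 0" "int (nat T') = T'" using T by auto
    have "n * T'\<^sup>2 = (j * x + M * a)\<^sup>2 + (j * y + M * b)\<^sup>2 + (j * z + M * c)\<^sup>2"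
    proof -
      have "(j * x + M * a)\<^sup>2 + (j * y + M * b)\<^sup>2 + (j * z + M * c)\<^sup>2
          = j\<^sup>2 * (x\<^sup>2 + y\<^sup>2 + z\<^sup>2) + 2 * j * M * d + M\<^sup>2 * A"
        by (simp add: d_def A_def power2_eq_square algebra_simps)
      also have "\<dots> = j\<^sup>2 * (n * (int T)\<^sup>2) + 2 * j * M * d + M\<^sup>2 * A" using less by simp
      also have "\<dots> = n * T'\<^sup>2"
      proof -
        have "A = j + n" by (simp add: j_def)
        moreover have "2 * d = 2 * n * int T - M" by (simp add: M_def)
        then have "2 * j * M * d = j * M * (2 * n * int T - M)" by (metis mult.assoc mult.left_commute)
        ultimately show ?thesis by (simp add: T'_def power2_eq_square algebra_simps)
      qed
      finally show ?thesis ..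
    qed
    then show ?thesis using less.IH[OF T'(1,2)] T'(3) by metis
  qed
qed

section \<open>Three squares from reciprocity and an auxiliary prime\<close>

lemma Legendre_eq_1D:
  assumes "Legendre a p = 1"
  obtains y where "p dvd y\<^sup>2 - a"
  using assms unfolding Legendre_def QuadRes_def by (auto split: if_splits simp: cong_iff_dvd_diff)

lemma square_root_mod_prod_primes:
  fixes c :: int and P :: "nat set"
  assumes "finite P" "\<And>p. p \<in> P \<Longrightarrow> prime p" "\<And>p. p \<in> P \<Longrightarrow> \<exists>y. int p dvd y\<^sup>2 + c"
  shows "\<exists>y. int (\<Prod>P) dvd y\<^sup>2 + c"
  using assms
proof (induction P rule: finite_induct)
  case (insert p P)
  obtain u where u: "int p dvd u\<^sup>2 + c" using insert by auto
  obtain v where v: "int (\<Prod>P) dvd v\<^sup>2 + c" using insert by auto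
  have "coprime p (\<Prod>P)"
    using insert by (intro prod_coprime_right) (auto intro!: primes_coprime)
  then have cop: "coprime (int p) (int (\<Prod>P))" by (simp only: coprime_int_iff)
  obtain x where x: "[x = u] (mod int p)" "[x = v] (mod int (\<Prod>P))"
    using binary_chinese_remainder_int[OF cop] by blast
  have "[x\<^sup>2 + c = u\<^sup>2 + c] (mod int p)" "[x\<^sup>2 + c = v\<^sup>2 + c] (mod int (\<Prod>P))"
    using x by (auto intro!: cong_add cong_pow)
  then have "int p dvd x\<^sup>2 + c" "int (\<Prod>P) dvd x\<^sup>2 + c"
    using u v cong_dvd_iff by blast+
  then have "int p * int (\<Prod>P) dvd x\<^sup>2 + c" using cop by (rule divides_mult)
  then show ?case using insert by auto
qed simp

text \<open>The value of \<open>\<kappa>\<close> is chosen to make the product of the Legendre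
  symbols of \<open>-\<kappa>\<close> over the primes dividing \<open>n\<close> equal to
  \<open>1\<close>: it is \<open>chi_minus4 n\<close> or \<open>chi_minus8 n\<close>. By reciprocity
  this product is also the symbol of \<open>n\<close> modulo the auxiliary prime
  \<open>q\<close>.\<close>

lemma three_squares_squarefree:
  fixes n \<kappa> :: nat
  assumes sf: "squarefree n" and n\<kappa>: "n mod 4 = 1 \<and> \<kappa> = 1 \<or> n mod 8 = 3 \<and> \<kappa> = 2"
  shows "\<exists>a b c::int. int n = a\<^sup>2 + b\<^sup>2 + c\<^sup>2"
proof -
  have odd_n: "odd n" using n\<kappa> by presburger
  then have n0: "n > 0" by (cases n) auto
  define P where "P = prime_factors n"
  have finP: "finite P" by (simp add: P_def)
  have P: "prime p" "p > 2" "p dvd n" if "p \<in> P" for p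
  proof -
    show "prime p" "p dvd n" using that by (auto simp: P_def)
    then have "p \<noteq> 2" "p \<ge> 2" using odd_n prime_ge_2_nat by auto
    then show "p > 2" by simp
  qed
  have nP: "n = \<Prod>P"
  proof -
    have "n = (\<Prod>p\<in>P. p ^ multiplicity p n)"
      using prime_factorization_nat[OF n0] by (simp add: P_def)
    also have "\<dots> = (\<Prod>p\<in>P. p)"
    proof (rule prod.cong)
      fix p assume p: "p \<in> P"
      have "multiplicity p n \<le> 1"
        using squarefree_factorial_semiring''[of n] n0 sf P(1)[OF p] by auto
      moreover have "multiplicity p n > 0"
        using P[OF p] n0 by (simp add: prime_multiplicity_gt_zero_iff)
      ultimately have "multiplicity p n = 1" by simp
      then show "p ^ multiplicity p n = p" by simp
    qed simp
    finally show ?thesis by simp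
  qed
  have \<kappa>12: "\<kappa> = 1 \<or> \<kappa> = 2" using n\<kappa> by auto
  \<comment> \<open>Giving \<open>q\<close> the symbol \<open>e p\<close> modulo each
    \<open>p\<close> makes \<open>- \<kappa> * q\<close> a square modulo \<open>p\<close>, since
    \<open>e p * e p = 1\<close>.\<close>
  define e where "e p = Legendre (- int \<kappa>) (int p)" for p :: nat
  have prod_e: "(\<Prod>p\<in>P. e p) = 1"
    using n\<kappa>
  proof
    assume *: "n mod 4 = 1 \<and> \<kappa> = 1"
    have "e p = chi_minus4 p" if "p \<in> P" for p
    proof -
      have "odd p" using P[OF that] prime_odd_nat by auto
      then have "p mod 4 = 1 \<or> p mod 4 = 3" by presburger
      then show ?thesis using * Legendre_minus_1[OF P(1,2)[OF that]] by (auto simp: e_def chi_minus4_def)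
    qed
    then have "(\<Prod>p\<in>P. e p) = chi_minus4 n" by (simp add: nP chi_minus4_prod)
    then show ?thesis using * by (simp add: chi_minus4_def)
  next
    assume *: "n mod 8 = 3 \<and> \<kappa> = 2"
    have "e p = chi_minus8 p" if "p \<in> P" for p
    proof -
      have "odd p" using P[OF that] prime_odd_nat by auto
      then have "p mod 8 = 1 \<or> p mod 8 = 3 \<or> p mod 8 = 5 \<or> p mod 8 = 7" by presburger
      then show ?thesis using * Legendre_minus_2[OF P(1,2)[OF that]] by (auto simp: e_def chi_minus8_def)
    qed
    then have "(\<Prod>p\<in>P. e p) = chi_minus8 n" by (simp add: nP chi_minus8_prod)
    then show ?thesis using * by (simp add: chi_minus8_def)
  qed
  have e1: "e p = 1 \<or> e p = -1" if "p \<in> P" for p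
  proof -
    have "\<not> int p dvd - int \<kappa>"
      using P(2)[OF that] \<kappa>12 by (auto dest: zdvd_imp_le)
    then show ?thesis using Legendre_vals[of "- int \<kappa>" "int p"] Legendre_eq_0_iff[of "- int \<kappa>" "int p"]
      by (auto simp: e_def)
  qed
  obtain q where q: "prime q" "chi_minus4 q = 1" "\<And>p. p \<in> P \<Longrightarrow> Legendre (int q) (int p) = e p"
  proof -
    \<comment> \<open>Every index is its own modulus. The index \<open>4\<close> stands for
      \<open>chi_minus4\<close> and cannot clash with the primes in \<open>P\<close>.\<close>
    define X where "X i = (\<lambda>k. real_of_int (if i = 4 then chi_minus4 k else Legendre (int k) (int i)))" for i :: nat
    define d where "d i = (if i = 4 then 1 else real_of_int (e i))" for i :: nat
    have "4 \<notin> P"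
    proof
      assume "4 \<in> P"
      then have "prime (2 ^ 2 :: nat)" using P by fastforce
      then show False unfolding prime_power_iff by simp
    qed
    have "\<exists>q. prime q \<and> (\<forall>i\<in>insert 4 P. X i q = d i)"
    proof (rule prime_with_prescribed_real_characters[where m = "\<lambda>i. i"])
      show "real_character (X i) i" if "i \<in> insert 4 P" for i
        using that real_character_chi_minus4 real_character_Legendre[OF P(1,2), of i] \<open>4 \<notin> P\<close>
        by (cases "i = 4") (auto simp: X_def)
      have c4: "coprime p 4" if "p \<in> P" for p
      proof -
        have "coprime p 2" using P[OF that] prime_odd_nat[of p] by simp
        then have "coprime p (2 ^ 2)" by (subst coprime_power_right_iff) simp
        then show ?thesis by simp
      qed
      show "coprime i j" if "i \<in> insert 4 P" "j \<in> insert 4 P" "i \<noteq> j" for i j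
        using that c4 P(1) primes_coprime[of i j] by (auto simp: coprime_commute)
      show "d i = 1 \<or> d i = -1" if "i \<in> insert 4 P" for i
        using that e1[of i] by (auto simp: d_def)
    qed (use finP in auto)
    then obtain q where "prime q" "\<And>i. i \<in> insert 4 P \<Longrightarrow> X i q = d i" by blast
    moreover from this(2)[of 4] have "chi_minus4 q = 1" by (simp add: X_def d_def)
    moreover have "Legendre (int q) (int p) = e p" if "p \<in> P" for p
      using calculation(2)[of p] that \<open>4 \<notin> P\<close> by (cases "p = 4") (simp_all add: X_def d_def)
    ultimately show thesis by (intro that)
  qed
  have q4: "q mod 4 = 1" using q(2) by (simp add: chi_minus4_def split: if_splits)
  have q2: "q > 2" using q4 prime_ge_2_nat[OF q(1)] by (cases "q = 2") auto
  have qP: "q \<notin> P"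
  proof
    assume "q \<in> P"
    then have "e q = 0" using q(3)[of q] Legendre_eq_0_iff[of "int q" "int q"] by simp
    then show False using e1[OF \<open>q \<in> P\<close>] by simp
  qed
  then have qn: "\<not> q dvd n"
    using q(1) n0 by (simp add: P_def in_prime_factors_iff)
  define Q where "Q = \<kappa> * q"
  have Q0: "Q > 0" using q2 \<kappa>12 by (auto simp: Q_def)
  have "\<exists>y. int p dvd y\<^sup>2 + int Q" if "p \<in> P" for p
  proof -
    have "Legendre (- int Q) (int p) = e p * Legendre (int q) (int p)"
      using Legendre_mult[OF P(1,2)[OF that], of "- int \<kappa>" "int q"] by (simp add: Q_def e_def)
    also have "\<dots> = 1" using q(3)[OF that] e1[OF that] by auto
    finally obtain y where "int p dvd y\<^sup>2 - (- int Q)" by (rule Legendre_eq_1D)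
    then show ?thesis by auto
  qed
  from square_root_mod_prod_primes[OF finP P(1) this]
  obtain \<alpha> where \<alpha>: "int n dvd \<alpha>\<^sup>2 + int Q" unfolding nP by blast
  have "Legendre (int n) (int q) = (\<Prod>p\<in>P. Legendre (int p) (int q))"
    using Legendre_prod[OF q(1) q2 finP, of int] by (simp add: nP)
  also have "\<dots> = (\<Prod>p\<in>P. e p)"
  proof (rule prod.cong)
    fix p assume p: "p \<in> P"
    \<comment> \<open>Since \<open>q\<close> is \<open>1\<close> modulo \<open>4\<close>,
      reciprocity has no sign.\<close>
    have "even ((q - 1) div 2)" using q4 by presburger
    then have "Legendre (int p) (int q) * Legendre (int q) (int p) = 1"
      using Quadratic_Reciprocity[OF P(1,2)[OF p] q(1) q2] p qP by auto
    then show "Legendre (int p) (int q) = e p" using q(3)[OF p] e1[OF p] by auto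
  qed simp
  finally have "Legendre (int n) (int q) = 1" using prod_e by simp
  then obtain y where y: "int q dvd y\<^sup>2 - int n" by (rule Legendre_eq_1D)
  obtain \<beta> where \<beta>: "int Q dvd \<beta>\<^sup>2 - int n"
    using \<kappa>12
  proof
    assume "\<kappa> = 1"
    then show thesis using y that by (simp add: Q_def)
  next
    assume \<kappa>: "\<kappa> = 2"
    have oq: "odd (int q)" using q4 by presburger
    \<comment> \<open>Shifting an even root by the odd \<open>q\<close> makes it odd, so that
      \<open>b^2 - n\<close> is divisible by \<open>2\<close> as well as by
      \<open>q\<close>.\<close>
    define b where "b = (if odd y then y else y + int q)"
    have "int q dvd b\<^sup>2 - int n"
    proof -
      have "b\<^sup>2 - int n = (y\<^sup>2 - int n) + int q * (if odd y then 0 else 2 * y + int q)"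
        by (simp add: b_def power2_eq_square algebra_simps)
      also have "int q dvd \<dots>" by (intro dvd_add y dvd_triv_left)
      finally show ?thesis .
    qed
    moreover have "2 dvd b\<^sup>2 - int n" using odd_n oq by (auto simp: b_def)
    moreover have "coprime 2 (int q)" using oq by simp
    ultimately have "2 * int q dvd b\<^sup>2 - int n" by (intro divides_mult) auto
    then show thesis using that \<kappa> by (simp add: Q_def)
  qed
  have copnq: "coprime n q" using qn q(1) by (metis coprime_commute prime_imp_coprime)
  then have cop: "coprime n Q" using \<kappa>12 odd_n by (auto simp: Q_def)
  \<comment> \<open>The prime \<open>q\<close> divides \<open>Q\<close> and \<open>n * Q\<close>
    exactly once, so neither is a square.\<close>
  have mult_q: "multiplicity q Q = 1" "multiplicity q n = 0"
  proof -
    have "\<not> q dvd \<kappa>" using \<kappa>12 q2 by (auto dest: dvd_imp_le)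
    then show "multiplicity q Q = 1" unfolding Q_def using q(1) \<kappa>12
      by (auto simp: prime_elem_multiplicity_mult_distrib not_dvd_imp_multiplicity_0)
    show "multiplicity q n = 0" using qn by (rule not_dvd_imp_multiplicity_0)
  qed
  have nsq: "x\<^sup>2 \<noteq> int k" if "multiplicity q k = 1" for x :: int and k
  proof
    assume eq: "x\<^sup>2 = int k"
    then have k: "(nat \<bar>x\<bar>)\<^sup>2 = k" by (metis nat_abs_mult_distrib nat_int abs_of_nat power2_eq_square)
    have "nat \<bar>x\<bar> \<noteq> 0" using k that by (cases "nat \<bar>x\<bar> = 0") auto
    then have "multiplicity q k = 2 * multiplicity q (nat \<bar>x\<bar>)"
      using q(1) unfolding k[symmetric] by (simp add: prime_elem_multiplicity_power_distrib)
    then show False using that by simp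
  qed
  have "multiplicity q (n * Q) = 1"
    using mult_q q(1) n0 Q0 by (simp add: prime_elem_multiplicity_mult_distrib)
  from legendre_isotropic[OF n0 Q0 cop \<alpha> \<beta> nsq[OF mult_q(1)] nsq[OF this]]
  obtain T z s :: int where T: "T > 0" "int n * T\<^sup>2 = z\<^sup>2 + int Q * s\<^sup>2" .
  have "Legendre (-1) (int q) = 1" using Legendre_minus_1[OF q(1) q2] q4 by simp
  then obtain w where "int q dvd w\<^sup>2 - (-1)" by (rule Legendre_eq_1D)
  then have "int q dvd w\<^sup>2 + 1" by simp
  then obtain u v :: int where uv: "int q = u\<^sup>2 + v\<^sup>2" using prime_sum_of_two_squares[OF q(1)] by blast
  obtain f g :: int where fg: "int Q = f\<^sup>2 + g\<^sup>2"
    using \<kappa>12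
  proof
    assume "\<kappa> = 1"
    then show thesis using uv that by (simp add: Q_def)
  next
    assume "\<kappa> = 2"
    \<comment> \<open>Twice a sum of two squares is again one.\<close>
    then have "int Q = (u + v)\<^sup>2 + (u - v)\<^sup>2" using uv by (simp add: Q_def power2_eq_square algebra_simps)
    then show thesis by (rule that)
  qed
  have "int n * (int (nat T))\<^sup>2 = z\<^sup>2 + (f * s)\<^sup>2 + (g * s)\<^sup>2"
    using T by (simp add: fg power_mult_distrib algebra_simps)
  then show ?thesis using davenport_cassels[of "nat T"] T(1) by simp
qed

text \<open>An odd square is \<open>1\<close> modulo \<open>8\<close>, so the squarefree part of
  \<open>n\<close> lies in the same residue class as \<open>n\<close>; the square part then scales
  the representation.\<close>

theorem three_squares:
  fixes n :: nat
  assumes "n mod 4 = 1 \<or> n mod 8 = 3"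
  shows "\<exists>a b c::int. int n = a\<^sup>2 + b\<^sup>2 + c\<^sup>2"
proof -
  define m where "m = squarefree_part n"
  define r where "r = square_part n"
  have n: "n = m * r\<^sup>2" unfolding m_def r_def by (rule squarefree_decompose)
  have "odd n" using assms by presburger
  then have "odd r" using n by auto
  then obtain k where "r = 2 * k + 1" by (elim oddE)
  then have "r\<^sup>2 = 4 * (k * (k + 1)) + 1" by (simp add: power2_eq_square algebra_simps)
  moreover have "even (k * (k + 1))" by simp
  then obtain l where "k * (k + 1) = 2 * l" by (elim evenE)
  ultimately have "r\<^sup>2 = 8 * l + 1" by simp
  then have "n = 8 * (m * l) + m" using n by (simp add: algebra_simps)
  then have "n mod 8 = m mod 8" by simp
  moreover have "n mod 4 = n mod 8 mod 4" "m mod 4 = m mod 8 mod 4" by (simp_all add: mod_mod_cancel)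
  ultimately have "n mod 8 = m mod 8" "n mod 4 = m mod 4" by simp_all
  then obtain \<kappa> :: nat where "m mod 4 = 1 \<and> \<kappa> = 1 \<or> m mod 8 = 3 \<and> \<kappa> = 2" using assms by metis
  from three_squares_squarefree[OF _ this]
  obtain a b c :: int where abc: "int m = a\<^sup>2 + b\<^sup>2 + c\<^sup>2" by (auto simp: m_def)
  have "int n = (a * int r)\<^sup>2 + (b * int r)\<^sup>2 + (c * int r)\<^sup>2"
    by (simp add: n abc power_mult_distrib algebra_simps)
  then show ?thesis by blast
qed

section \<open>The form with coefficients 2, 3, 6, 7\<close>

text \<open>The coordinates of \<open>(a, b, c)\<close> along the three orthogonal vectors are
  \<open>(a - b)/2\<close>, \<open>(a + b + c)/3\<close> and \<open>(a + b - 2 * c)/6\<close>; the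
  two hypotheses make them integral.\<close>

lemma same_parity_represents_236:
  fixes a b c :: int
  assumes "3 dvd a + b + c" "even (a + b)"
  shows "\<exists>x y z. a\<^sup>2 + b\<^sup>2 + c\<^sup>2 = 2 * x\<^sup>2 + 3 * y\<^sup>2 + 6 * z\<^sup>2"
proof -
  obtain y where y: "a + b + c = 3 * y" using assms(1) by blast
  obtain h where h: "a + b = 2 * h" using assms(2) by blast
  have "a = y + (h - b) + (h - y)" "b = y - (h - b) + (h - y)" "c = y - 2 * (h - y)"
    using y h by presburger+
  then have "a\<^sup>2 + b\<^sup>2 + c\<^sup>2 = (y + (h - b) + (h - y))\<^sup>2 + (y - (h - b) + (h - y))\<^sup>2 + (y - 2 * (h - y))\<^sup>2"
    by simp
  also have "\<dots> = 2 * (h - b)\<^sup>2 + 3 * y\<^sup>2 + 6 * (h - y)\<^sup>2"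
    by (simp add: power2_eq_square algebra_simps)
  finally show ?thesis by blast
qed

text \<open>Squares are \<open>0\<close> or \<open>1\<close> modulo \<open>3\<close>, so the number
  of bases not divisible by \<open>3\<close> is \<open>0\<close>, \<open>2\<close> or
  \<open>3\<close>. In each case suitable signs give a sum divisible by \<open>3\<close>, and
  changing signs does not affect parities.\<close>

lemma three_squares_represents_236:
  fixes a b c m :: int
  assumes m: "m = a\<^sup>2 + b\<^sup>2 + c\<^sup>2" "m mod 3 \<noteq> 1"
  shows "\<exists>x y z. m = 2 * x\<^sup>2 + 3 * y\<^sup>2 + 6 * z\<^sup>2"
proof -
  have sq: "x\<^sup>2 mod 3 = (if x mod 3 = 0 then 0 else 1)" for x :: int
  proof -
    have "x mod 3 = 0 \<or> x mod 3 = 1 \<or> x mod 3 = 2" by presburger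
    then show ?thesis unfolding power_mod[of x 3 2, symmetric] by auto
  qed
  have eq: "m mod 3 = (a\<^sup>2 mod 3 + b\<^sup>2 mod 3 + c\<^sup>2 mod 3) mod 3"
    unfolding m(1) mod_add_eq[of "a\<^sup>2 + b\<^sup>2" 3 "c\<^sup>2", symmetric] mod_add_eq[of "a\<^sup>2" 3 "b\<^sup>2", symmetric]
    by (rule mod_add_left_eq)
  have ne: "(a\<^sup>2 mod 3 + b\<^sup>2 mod 3 + c\<^sup>2 mod 3) mod 3 \<noteq> 1" using m(2) unfolding eq .
  have "\<exists>e f g. (e = a \<or> e = -a) \<and> (f = b \<or> f = -b) \<and> (g = c \<or> g = -c) \<and> 3 dvd e + f + g"
  proof -
    have "a mod 3 = 0 \<or> a mod 3 = 1 \<or> a mod 3 = 2" "b mod 3 = 0 \<or> b mod 3 = 1 \<or> b mod 3 = 2"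
      "c mod 3 = 0 \<or> c mod 3 = 1 \<or> c mod 3 = 2" by presburger+
    then have "3 dvd a + b + c \<or> 3 dvd a + b - c \<or> 3 dvd a - b + c \<or> 3 dvd - a + b + c"
      using ne unfolding sq by (elim disjE) (simp_all, presburger+)
    then show ?thesis by (metis add.commute add_uminus_conv_diff)
  qed
  then obtain e f g where efg: "e = a \<or> e = -a" "f = b \<or> f = -b" "g = c \<or> g = -c" "3 dvd e + f + g"
    by blast
  have m': "m = e\<^sup>2 + f\<^sup>2 + g\<^sup>2" using efg m(1) by auto
  have "even (e + f) \<or> even (f + g) \<or> even (e + g)" by auto
  then show ?thesis
  proof (elim disjE)
    assume "even (e + f)"
    then show ?thesis using same_parity_represents_236[OF efg(4)] m' by simp
  next
    assume "even (f + g)"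
    then show ?thesis using same_parity_represents_236[of f g e] efg(4) m' by (simp add: ac_simps)
  next
    assume "even (e + g)"
    then show ?thesis using same_parity_represents_236[of e g f] efg(4) m' by (simp add: ac_simps)
  qed
qed

section \<open>Diagonal forms and inserted coefficients\<close>

lemma diag_form_Nil: "diag_form [] xs = 0"
  by (simp add: diag_form_def)

lemma diag_form_Cons: "diag_form (a # as) (x # xs) = int a * x\<^sup>2 + diag_form as xs"
  unfolding diag_form_def by (simp add: sum.lessThan_Suc_shift del: sum.lessThan_Suc)

lemma diag_form_append:
  "length xs = length as \<Longrightarrow> diag_form (as @ bs) (xs @ ys) = diag_form as xs + diag_form bs ys"
  by (induction xs as rule: list_induct2) (simp_all add: diag_form_Nil diag_form_Cons)

lemma representsI:
  "length xs = length as \<Longrightarrow> diag_form as xs = int m \<Longrightarrow> represents as m"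
  by (auto simp: represents_def)

text \<open>The position is arbitrary because a new coefficient is not always the last one, as in
  \<open>[2, 3, 6, a, 7]\<close>.\<close>

lemma represents_insert:
  assumes "represents (as @ bs) m"
  shows "represents (as @ a # bs) (m + a * t\<^sup>2)"
proof -
  obtain zs where zs: "length zs = length (as @ bs)" "diag_form (as @ bs) zs = int m"
    using assms by (auto simp: represents_def)
  define xs ys where "xs = take (length as) zs" and "ys = drop (length as) zs"
  have "zs = xs @ ys" "length xs = length as" "length ys = length bs"
    using zs by (simp_all add: xs_def ys_def)
  then show ?thesis
    using zs by (intro representsI[of "xs @ int t # ys"])
      (simp_all add: diag_form_append diag_form_Cons)
qed

lemma represents_insert_0: "represents (as @ bs) m \<Longrightarrow> represents (as @ a # bs) m"
  using represents_insert[of as bs m a 0] by simp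

lemma represents_2367_iff:
  "represents [2, 3, 6, 7] m \<longleftrightarrow> (\<exists>x y z w. 2 * x\<^sup>2 + 3 * y\<^sup>2 + 6 * z\<^sup>2 + 7 * w\<^sup>2 = int m)"
proof
  assume "represents [2, 3, 6, 7] m"
  then obtain x y z w where "diag_form [2, 3, 6, 7] [x, y, z, w] = int m"
    by (auto simp: represents_def length_Suc_conv)
  then have "2 * x\<^sup>2 + 3 * y\<^sup>2 + 6 * z\<^sup>2 + 7 * w\<^sup>2 = int m" by (simp add: diag_form_Cons diag_form_Nil)
  then show "\<exists>x y z w. 2 * x\<^sup>2 + 3 * y\<^sup>2 + 6 * z\<^sup>2 + 7 * w\<^sup>2 = int m" by blast
next
  assume "\<exists>x y z w. 2 * x\<^sup>2 + 3 * y\<^sup>2 + 6 * z\<^sup>2 + 7 * w\<^sup>2 = int m"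
  then obtain x y z w :: int where "2 * x\<^sup>2 + 3 * y\<^sup>2 + 6 * z\<^sup>2 + 7 * w\<^sup>2 = int m" by blast
  then show "represents [2, 3, 6, 7] m"
    by (intro representsI[of "[x, y, z, w]"]) (simp_all add: diag_form_Cons diag_form_Nil)
qed

section \<open>Primes represented by the quaternary form\<close>

lemma represents_2367_if_three_squares:
  assumes "n mod 3 \<noteq> 1" "n mod 4 = 1 \<or> n mod 8 = 3"
  shows "represents [2, 3, 6, 7] (n + 7 * w\<^sup>2)"
proof -
  obtain a b c :: int where "int n = a\<^sup>2 + b\<^sup>2 + c\<^sup>2" using three_squares[OF assms(2)] by blast
  moreover have "int n mod 3 \<noteq> 1" using assms(1) by presburger
  ultimately obtain x y z where "int n = 2 * x\<^sup>2 + 3 * y\<^sup>2 + 6 * z\<^sup>2"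
    using three_squares_represents_236 by blast
  then show ?thesis unfolding represents_2367_iff by (intro exI[of _ x] exI[of _ y] exI[of _ z] exI[of _ "int w"]) simp
qed

text \<open>These \<open>r\<close> are exactly the residues modulo \<open>24\<close> that are not
  \<open>1\<close> modulo \<open>3\<close> and are \<open>1\<close> modulo \<open>4\<close> or
  \<open>3\<close> modulo \<open>8\<close>.\<close>

lemma represents_2367_24:
  assumes "r \<in> {3, 5, 9, 11, 17, 21}"
  shows "represents [2, 3, 6, 7] (24 * k + r + 7 * w\<^sup>2)"
proof (rule represents_2367_if_three_squares)
  have "(24 * k + r) mod 3 = r mod 3" "(24 * k + r) mod 8 = r mod 8" "(24 * k + r) mod 4 = r mod 4"
    using mod_mult_self4[of 3 "8 * k" r] mod_mult_self4[of 8 "3 * k" r] mod_mult_self4[of 4 "6 * k" r] by simp_all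
  then show "(24 * k + r) mod 3 \<noteq> 1" "(24 * k + r) mod 4 = 1 \<or> (24 * k + r) mod 8 = 3"
    using assms by auto
qed

text \<open>The entries of \<open>W\<close> list a number followed by values of the four variables.
  The range reaches \<open>60 = 67 - 7\<close>, the largest remainder needed when a coefficient of
  at least \<open>7\<close> is appended.\<close>

lemma represents_2367_small:
  assumes "m \<le> 60" "m \<notin> {1, 4, 22, 23, 47}"
  shows "represents [2, 3, 6, 7] m"
proof -
  define W :: "(nat \<times> nat \<times> nat \<times> nat \<times> nat) list" where
    "W = [(0, 0, 0, 0, 0), (2, 1, 0, 0, 0), (3, 0, 1, 0, 0), (5, 1, 1, 0, 0), (6, 0, 0, 1, 0),
      (7, 0, 0, 0, 1), (8, 1, 0, 1, 0), (9, 0, 1, 1, 0), (10, 0, 1, 0, 1), (11, 1, 1, 1, 0),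
      (12, 0, 2, 0, 0), (13, 0, 0, 1, 1), (14, 1, 2, 0, 0), (15, 1, 0, 1, 1), (16, 0, 1, 1, 1),
      (17, 2, 1, 1, 0), (18, 0, 2, 1, 0), (19, 0, 2, 0, 1), (20, 1, 2, 1, 0), (21, 1, 2, 0, 1),
      (24, 0, 0, 2, 0), (25, 0, 2, 1, 1), (26, 1, 0, 2, 0), (27, 0, 1, 2, 0), (28, 0, 0, 0, 2),
      (29, 1, 1, 2, 0), (30, 1, 0, 0, 2), (31, 0, 0, 2, 1), (32, 2, 0, 2, 0), (33, 0, 3, 1, 0),
      (34, 0, 0, 1, 2), (35, 1, 3, 1, 0), (36, 0, 2, 2, 0), (37, 0, 1, 1, 2), (38, 1, 2, 2, 0),
      (39, 1, 1, 1, 2), (40, 0, 2, 0, 2), (41, 2, 3, 1, 0), (42, 1, 2, 0, 2), (43, 0, 2, 2, 1),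
      (44, 2, 2, 2, 0), (45, 1, 2, 2, 1), (46, 0, 2, 1, 2), (48, 0, 4, 0, 0), (49, 3, 0, 2, 1),
      (50, 1, 4, 0, 0), (51, 0, 3, 2, 0), (52, 0, 0, 2, 2), (53, 1, 3, 2, 0), (54, 0, 0, 3, 0),
      (55, 0, 1, 2, 2), (56, 1, 0, 3, 0), (57, 0, 1, 3, 0), (58, 0, 3, 2, 1), (59, 1, 1, 3, 0),
      (60, 1, 3, 2, 1)]"
  have W: "\<forall>(m, x, y, z, w) \<in> set W. 2 * x\<^sup>2 + 3 * y\<^sup>2 + 6 * z\<^sup>2 + 7 * w\<^sup>2 = m"
    by (simp add: W_def)
  have "\<forall>m\<in>set [2..<61]. m \<in> {4, 22, 23, 47} \<or> m \<in> fst ` set W" by (simp add: W_def)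
  then have "m \<in> {4, 22, 23, 47} \<or> m \<in> fst ` set W" if "2 \<le> m" using assms(1) that unfolding set_upt by simp
  moreover have "0 \<in> fst ` set W" by (simp add: W_def)
  moreover have "m = 0 \<or> 2 \<le> m" using assms(2) by auto
  ultimately have "m \<in> fst ` set W" using assms(2) by blast
  then obtain x y z w where "(m, x, y, z, w) \<in> set W" by force
  then have "2 * x\<^sup>2 + 3 * y\<^sup>2 + 6 * z\<^sup>2 + 7 * w\<^sup>2 = m" using W by blast
  then have "2 * (int x)\<^sup>2 + 3 * (int y)\<^sup>2 + 6 * (int z)\<^sup>2 + 7 * (int w)\<^sup>2 = int m" by auto
  then show ?thesis unfolding represents_2367_iff by blast
qed

lemma prime_represented_by_2367:
  assumes p: "prime p" "p \<notin> {23, 47, 67}"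
  shows "represents [2, 3, 6, 7] p"
proof (cases "p \<le> 60")
  case True
  have "p \<noteq> 1" "p \<noteq> 4" "p \<noteq> 22"
    using p(1) prime_nat_not_dvd[of p 2] by auto
  then show ?thesis using True p by (intro represents_2367_small) auto
next
  case False
  define k r where "k = p div 24" and "r = p mod 24"
  have pk: "p = 24 * k + r" by (simp add: k_def r_def)
  have "\<not> 2 dvd p" "\<not> 3 dvd p"
    using False prime_nat_not_dvd[OF p(1), of 2] prime_nat_not_dvd[OF p(1), of 3] by auto
  then have "\<not> 2 dvd r" "\<not> 3 dvd r" by (auto simp: r_def dvd_mod_iff)
  moreover have "\<forall>r\<in>set [2..<24]. 2 dvd r \<or> 3 dvd r \<or> r \<in> {5, 7, 11, 13, 17, 19, 23::nat}" by simp
  then have "2 dvd r \<or> 3 dvd r \<or> r \<in> {5, 7, 11, 13, 17, 19, 23}" if "2 \<le> r"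
    using that unfolding set_upt by (simp add: r_def)
  moreover have "r = 0 \<or> r = 1 \<or> 2 \<le> r" by auto
  ultimately have "r \<in> {1, 5, 7, 11, 13, 17, 19, 23}" by fastforce
  \<comment> \<open>Modulo \<open>24\<close>, the values of \<open>7 * w^2\<close> for
    \<open>w = 0, 2, 4, 6\<close> are \<open>0, 4, 16, 12\<close>. Subtracting the first, second,
    third or fourth value, in the order of the cases, leads to an admissible residue once
    \<open>p\<close> is at least \<open>7 * w^2\<close>.\<close>
  then consider "r \<in> {5, 11, 17}" | "r \<in> {1, 7, 13}" | "r = 19" | "r = 23" by auto
  then show ?thesis
  proof cases
    case 1
    then show ?thesis using represents_2367_24[of r k 0] pk by auto
  next
    case 2
    have "k \<ge> 2" using False pk 2 by auto
    then obtain j where "k = j + 2" using le_Suc_ex[of 2 k] by (auto simp: add.commute)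
    then show ?thesis
      using 2 represents_2367_24[of 21 j 2] represents_2367_24[of 3 "j + 1" 2] represents_2367_24[of 9 "j + 1" 2] pk
      by auto
  next
    case 3
    \<comment> \<open>\<open>k = 3\<close> gives \<open>91 = 7 * 13\<close>, and
      \<open>k = 2\<close> gives the exception \<open>67\<close>.\<close>
    have "k \<noteq> 3" using prime_nat_not_dvd[OF p(1), of 7] pk 3 by auto
    moreover have "k \<noteq> 2" "k \<ge> 2" using False p(2) pk 3 by auto
    ultimately obtain j where "k = j + 4" using le_Suc_ex[of 4 k] by (auto simp: add.commute)
    then show ?thesis using represents_2367_24[of 3 j 4] pk 3 by simp
  next
    case 4
    show ?thesis
    proof (cases "k \<ge> 10")
      case True
      then obtain j where "k = j + 10" using le_Suc_ex[of 10 k] by (auto simp: add.commute)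
      then show ?thesis using represents_2367_24[of 11 j 6] pk 4 by simp
    next
      case k10: False
      have "k \<ge> 2" using False pk 4 by auto
      \<comment> \<open>These give the composite numbers \<open>95\<close>, \<open>119\<close>,
        \<open>143\<close> and \<open>215\<close>; the primes \<open>71\<close>, \<open>167\<close>,
        \<open>191\<close> and \<open>239\<close> remain and get explicit representations.\<close>
      moreover have "k \<notin> {3, 4, 5, 8}"
        using prime_nat_not_dvd[OF p(1), of 5] prime_nat_not_dvd[OF p(1), of 7] prime_nat_not_dvd[OF p(1), of 11] pk 4 by auto
      ultimately consider "k = 2" | "k = 6" | "k = 7" | "k = 9" using k10 by force
      then show ?thesis
      proof cases
        case 1
        then show ?thesis using pk 4 by (intro representsI[of "[2, 0, 0, 3]"]) (simp_all add: diag_form_Cons diag_form_Nil)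
      next
        case 2
        then show ?thesis using pk 4 by (intro representsI[of "[7, 0, 1, 3]"]) (simp_all add: diag_form_Cons diag_form_Nil)
      next
        case 3
        then show ?thesis using pk 4 by (intro representsI[of "[8, 0, 0, 3]"]) (simp_all add: diag_form_Cons diag_form_Nil)
      next
        case k9: 4
        then show ?thesis using pk 4 by (intro representsI[of "[8, 4, 0, 3]"]) (simp_all add: diag_form_Cons diag_form_Nil)
      qed
    qed
  qed
qed

section \<open>Numbers that are not represented\<close>

lemma small_square_cases:
  assumes "(x::int)\<^sup>2 < 36"
  shows "x\<^sup>2 \<in> {0, 1, 4, 9, 16, 25}"
proof -
  have "\<bar>x\<bar> < 6" using assms power2_less_imp_less[of "\<bar>x\<bar>" 6] by simp
  then have "\<bar>x\<bar> \<in> {0, 1, 2, 3, 4, 5}" by auto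
  moreover have "x\<^sup>2 = \<bar>x\<bar> * \<bar>x\<bar>" by (simp add: power2_eq_square)
  ultimately show ?thesis by (elim insertE) simp_all
qed

text \<open>Makes non-representation a finite check; the obtained variables are the squares
  themselves. As \<open>4 * 19 > 67\<close>, the last one can only be \<open>0\<close> or
  \<open>1\<close>.\<close>

lemma represents_2367_last_cases:
  assumes "represents [2, 3, 6, 7, a] m" "m < 68" "a \<ge> 19"
  obtains x y z w v :: int where
    "x \<in> {0, 1, 4, 9, 16, 25}" "y \<in> {0, 1, 4, 9, 16}" "z \<in> {0, 1, 4, 9}" "w \<in> {0, 1, 4, 9}" "v \<in> {0, 1}"
    "2 * x + 3 * y + 6 * z + 7 * w + int a * v = int m"
proof -
  obtain x y z w v where "diag_form [2, 3, 6, 7, a] [x, y, z, w, v] = int m"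
    using assms(1) by (auto simp: represents_def length_Suc_conv)
  then have eq: "2 * x\<^sup>2 + 3 * y\<^sup>2 + 6 * z\<^sup>2 + 7 * w\<^sup>2 + int a * v\<^sup>2 = int m"
    by (simp add: diag_form_Cons diag_form_Nil)
  have "19 * v\<^sup>2 \<le> int a * v\<^sup>2" using assms(3) by (intro mult_right_mono) auto
  moreover have nn: "0 \<le> x\<^sup>2" "0 \<le> y\<^sup>2" "0 \<le> z\<^sup>2" "0 \<le> w\<^sup>2" "0 \<le> v\<^sup>2" by simp_all
  ultimately have le: "2 * x\<^sup>2 \<le> 67" "3 * y\<^sup>2 \<le> 67" "6 * z\<^sup>2 \<le> 67" "7 * w\<^sup>2 \<le> 67" "19 * v\<^sup>2 \<le> 67"
    using eq assms(2) by linarith+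
  then have "x\<^sup>2 < 36" "y\<^sup>2 < 36" "z\<^sup>2 < 36" "w\<^sup>2 < 36" "v\<^sup>2 < 36" by linarith+
  note this[THEN small_square_cases]
  then have "x\<^sup>2 \<in> {0, 1, 4, 9, 16, 25}" "y\<^sup>2 \<in> {0, 1, 4, 9, 16}" "z\<^sup>2 \<in> {0, 1, 4, 9}"
    "w\<^sup>2 \<in> {0, 1, 4, 9}" "v\<^sup>2 \<in> {0, 1}" using le by auto
  then show thesis using eq by (rule that)
qed

text \<open>The coefficient \<open>48\<close> is a dummy: its variable vanishes in any representation of \<open>47\<close>.\<close>

lemma not_represents_2367:
  "\<not> represents [2, 3, 6, 7, 20] 67" "\<not> represents [2, 3, 6, 7, 48] 47"
  "\<not> represents [2, 3, 6, 7, 19] 23" "\<not> represents [2, 3, 6, 7, 22] 23"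
  by (rule notI, erule represents_2367_last_cases; (elim insertE emptyE)?; simp)+

section \<open>Prime-universal extensions\<close>

lemma prime_universalI:
  assumes "\<And>p. prime p \<Longrightarrow> p \<notin> {23, 47, 67} \<Longrightarrow> represents as p"
    and "represents as 23" "represents as 47" "represents as 67"
  shows "prime_universal as"
  unfolding prime_universal_def using assms by blast

lemma prime_represented_by_extension:
  assumes "prime p" "p \<notin> {23, 47, 67}"
  shows "represents [2, 3, 6, 7, a] p" "represents [2, 3, 6, 7, a, b] p" "represents [2, 3, 6, a, 7] p"
proof -
  have p: "represents [2, 3, 6, 7] p" using assms by (rule prime_represented_by_2367)
  show a: "represents [2, 3, 6, 7, a] p" using represents_insert_0[of "[2, 3, 6, 7]" "[]"] p by simp
  show "represents [2, 3, 6, 7, a, b] p" using represents_insert_0[of "[2, 3, 6, 7, a]" "[]"] a by simp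
  show "represents [2, 3, 6, a, 7] p" using represents_insert_0[of "[2, 3, 6]" "[7]"] p by simp
qed

lemma represents_2367_snoc:
  assumes "m = k + a * t\<^sup>2" "k \<le> 60" "k \<notin> {1, 4, 22, 23, 47}"
  shows "represents [2, 3, 6, 7, a] m"
  using represents_insert[of "[2, 3, 6, 7]" "[]" k a t] represents_2367_small[OF assms(2,3)] assms(1) by simp

lemma represents_2367_20:
  "represents [2, 3, 6, 7, 20] 23" "represents [2, 3, 6, 7, 20] 47"
  by (rule represents_2367_snoc[of _ 3 _ 1] represents_2367_snoc[of _ 27 _ 1]; simp)+

lemma represents_2367_20_snoc:
  assumes "m = k + 20 * s\<^sup>2 + b" "k \<le> 60" "k \<notin> {1, 4, 22, 23, 47}"
  shows "represents [2, 3, 6, 7, 20, b] m"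
  using represents_insert[of "[2, 3, 6, 7, 20]" "[]" _ b 1] represents_2367_snoc[OF refl assms(2,3), of 20 s] assms(1)
  by simp

lemma prime_universal_2367_snoc:
  assumes "7 \<le> a" "a \<le> 23" "a \<notin> {19, 20, 22}"
  shows "prime_universal [2, 3, 6, 7, a]"
proof (rule prime_universalI)
  show "represents [2, 3, 6, 7, a] 23"
    by (rule represents_2367_snoc[of _ "23 - a" _ 1]) (use assms in auto)
  show "represents [2, 3, 6, 7, a] 47"
    by (rule represents_2367_snoc[of _ "47 - a" _ 1]) (use assms in auto)
  show "represents [2, 3, 6, 7, a] 67"
    by (rule represents_2367_snoc[of _ "67 - a" _ 1]) (use assms in auto)
qed (rule prime_represented_by_extension)

lemma prime_universal_2367_20_snoc:
  assumes "20 \<le> b" "b \<le> 67" "b \<notin> {21, 23, 63, 66}"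
  shows "prime_universal [2, 3, 6, 7, 20, b]"
proof (rule prime_universalI)
  show "represents [2, 3, 6, 7, 20, b] 23" "represents [2, 3, 6, 7, 20, b] 47"
    using represents_insert_0[of "[2, 3, 6, 7, 20]" "[]"] represents_2367_20 by simp_all
  show "represents [2, 3, 6, 7, 20, b] 67"
  proof (cases "b \<in> {20, 44, 45}")
    case True
    then show ?thesis by (intro represents_2367_20_snoc[of _ "47 - b" 1]) auto
  next
    case False
    then show ?thesis by (intro represents_2367_20_snoc[of _ "67 - b" 0]) (use assms in auto)
  qed
qed (rule prime_represented_by_extension)

theorem theorem3p7:
  shows "(\<forall>p. prime p \<and> p \<notin> {23, 47, 67} \<longrightarrow> represents [2, 3, 6, 7] p) \<and>
     (\<forall>m \<in> {23, 47, 67}. \<not> represents [2, 3, 6, 7] m) \<and>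
     prime_universal [2, 3, 6, 6, 7] \<and>
     (\<forall>a5. 7 \<le> a5 \<and> a5 \<le> 23 \<and> a5 \<notin> {8, 19, 20, 22} \<longrightarrow>
        prime_universal [2, 3, 6, 7, a5]) \<and>
     prime_universal [2, 3, 6, 7, 19, 20] \<and>
     (\<forall>a6. 20 \<le> a6 \<and> a6 \<le> 67 \<and> a6 \<notin> {21, 23, 63, 66} \<longrightarrow>
        prime_universal [2, 3, 6, 7, 20, a6]) \<and>
     (\<forall>p. prime p \<and> p \<noteq> 23 \<longrightarrow> represents [2, 3, 6, 7, 19] p) \<and>
     \<not> represents [2, 3, 6, 7, 19] 23 \<and>
     (\<forall>p. prime p \<and> p \<noteq> 23 \<longrightarrow> represents [2, 3, 6, 7, 22] p) \<and>
     \<not> represents [2, 3, 6, 7, 22] 23 \<and>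
     (\<forall>p. prime p \<and> p \<noteq> 67 \<longrightarrow> represents [2, 3, 6, 7, 20] p) \<and>
     \<not> represents [2, 3, 6, 7, 20] 67"
proof (intro conjI allI ballI impI)
  fix p :: nat assume "prime p \<and> p \<notin> {23, 47, 67}"
  then show "represents [2, 3, 6, 7] p" by (intro prime_represented_by_2367) auto
next
  fix m :: nat assume m: "m \<in> {23, 47, 67}"
  \<comment> \<open>A representation would extend by a zero to the longer forms that are known to
    miss \<open>m\<close>.\<close>
  show "\<not> represents [2, 3, 6, 7] m"
    using m not_represents_2367 represents_insert_0[of "[2, 3, 6, 7]" "[]" m] by auto
next
  show "prime_universal [2, 3, 6, 6, 7]"
  proof (rule prime_universalI)
    show "represents [2, 3, 6, 6, 7] 23"
      by (rule representsI[of "[2, 1, 1, 1, 0]"]) (simp_all add: diag_form_Cons diag_form_Nil)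
    show "represents [2, 3, 6, 6, 7] 47"
      by (rule representsI[of "[4, 1, 1, 1, 0]"]) (simp_all add: diag_form_Cons diag_form_Nil)
    show "represents [2, 3, 6, 6, 7] 67"
      by (rule representsI[of "[0, 0, 1, 3, 1]"]) (simp_all add: diag_form_Cons diag_form_Nil)
  qed (rule prime_represented_by_extension)
next
  fix a :: nat assume "7 \<le> a \<and> a \<le> 23 \<and> a \<notin> {8, 19, 20, 22}"
  then show "prime_universal [2, 3, 6, 7, a]" by (intro prime_universal_2367_snoc) auto
next
  show "prime_universal [2, 3, 6, 7, 19, 20]"
  proof (rule prime_universalI)
    show "represents [2, 3, 6, 7, 19, 20] 23" "represents [2, 3, 6, 7, 19, 20] 47"
      using represents_insert_0[of "[2, 3, 6, 7]" "[20]"] represents_2367_20 by simp_all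
    have "represents [2, 3, 6, 7, 19] 67" by (rule represents_2367_snoc[of _ 48 _ 1]) auto
    then show "represents [2, 3, 6, 7, 19, 20] 67"
      using represents_insert_0[of "[2, 3, 6, 7, 19]" "[]"] by simp
  qed (rule prime_represented_by_extension)
next
  fix b :: nat assume "20 \<le> b \<and> b \<le> 67 \<and> b \<notin> {21, 23, 63, 66}"
  then show "prime_universal [2, 3, 6, 7, 20, b]" by (intro prime_universal_2367_20_snoc) auto
next
  fix p :: nat assume p: "prime p \<and> p \<noteq> 23"
  have "represents [2, 3, 6, 7, 19] 47" by (rule represents_2367_snoc[of _ 28 _ 1]) auto
  moreover have "represents [2, 3, 6, 7, 19] 67" by (rule represents_2367_snoc[of _ 48 _ 1]) auto
  ultimately show "represents [2, 3, 6, 7, 19] p"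
    using p prime_represented_by_extension(1)[of p 19] by blast
  have "represents [2, 3, 6, 7, 22] 47" by (rule represents_2367_snoc[of _ 25 _ 1]) auto
  moreover have "represents [2, 3, 6, 7, 22] 67" by (rule represents_2367_snoc[of _ 45 _ 1]) auto
  ultimately show "represents [2, 3, 6, 7, 22] p"
    using p prime_represented_by_extension(1)[of p 22] by blast
next
  fix p :: nat assume "prime p \<and> p \<noteq> 67"
  then show "represents [2, 3, 6, 7, 20] p"
    using represents_2367_20 prime_represented_by_extension(1)[of p 20] by blast
qed (rule not_represents_2367)+

end
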